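(* For any $\alpha\in[2,\infty]$, $$\dim_H\left\{x\in(0,1)\setminus\mathbb Q\colon\lim_{n\to\infty}\frac1n(b_1(x)+\cdots+b_n(x))=\alpha\right\}=1.$$
   Context: $\dim_H$ is Hausdorff dimension. Let $f(x)=\frac1{1-x}-\left\lfloor\frac1{1-x}\right\rfloor$ on $[0,1)$ (the Rényi map). For $x\in(0,1)\setminus\mathbb Q$ and $j\ge1$, $b_j(x)=\left\lfloor\frac1{1-f^{j-1}x}\right\rfloor+1\ge2$ is the $j$-th digit of the backward continued fraction expansion $x=1-\cfrac1{b_1(x)-\cfrac1{b_2(x)-\ddots}}$. *)

theory Defs
  imports "HOL-Analysis.Analysis"
begin

text \<open>The gauge \<open>diam(U)\<^sup>s\<close>, with the usual conventions that the empty set contributes \<open>0\<close> and that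
  \<open>diam(U)\<^sup>0 = 1\<close> for nonempty \<open>U\<close> (so that the \<open>0\<close>-dimensional measure is counting measure). The
  case \<open>s = 0\<close> is explicit because \<open>0 powr 0 = 0\<close>. It is only used on bounded sets.\<close>

definition diam_pow :: "real \<Rightarrow> 'a::metric_space set \<Rightarrow> ennreal" where
  "diam_pow s U =
     (if U = {} then 0 else if s = 0 then 1 else ennreal (diameter U powr s))"

text \<open>Covers by finitely many sets are included, since \<open>U i\<close> may be empty.\<close>

definition hausdorff_premeasure :: "real \<Rightarrow> real \<Rightarrow> 'a::metric_space set \<Rightarrow> ennreal" where
  "hausdorff_premeasure s \<delta> A =
     (INF U \<in> {U :: nat \<Rightarrow> 'a set.
                 A \<subseteq> (\<Union>i. U i) \<and> (\<forall>i. bounded (U i) \<and> diameter (U i) \<le> \<delta>)}.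
        \<Sum>i. diam_pow s (U i))"

definition hausdorff_measure :: "real \<Rightarrow> 'a::metric_space set \<Rightarrow> ennreal" where
  "hausdorff_measure s A = (SUP \<delta> \<in> {0<..}. hausdorff_premeasure s \<delta> A)"

text \<open>The value is taken in \<open>ennreal\<close> so that the infimum over the empty set is \<open>\<infinity>\<close>.\<close>

definition hausdorff_dim :: "'a::metric_space set \<Rightarrow> ennreal" where
  "hausdorff_dim A = (INF s \<in> {s. 0 \<le> s \<and> hausdorff_measure s A = 0}. ennreal s)"

text \<open>The Renyi map; only its values on \<open>[0,1)\<close>, which it maps into itself, are meaningful.\<close>

definition renyi :: "real \<Rightarrow> real" where
  "renyi x = 1 / (1 - x) - of_int \<lfloor>1 / (1 - x)\<rfloor>"

text \<open>The \<open>j\<close>-th digit of the backward continued fraction expansion, for \<open>j \<ge> 1\<close>.\<close>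

definition bcf_digit :: "nat \<Rightarrow> real \<Rightarrow> int" where
  "bcf_digit j x = \<lfloor>1 / (1 - (renyi ^^ (j - 1)) x)\<rfloor> + 1"

end

theory Submission
  imports Defs "HOL-Library.Discrete_Functions" "HOL-Library.Sublist" "HOL-Real_Asymp.Real_Asymp"
begin

text \<open>The set lies in \<open>[0,1]\<close>, so its dimension is at most \<open>1\<close>. For the lower bound, fix \<open>s < 1\<close>; it is
  enough to find a map \<open>h\<close> from \<open>[0,1)\<close>, up to a countable set, into the given set with
  \<open>\<bar>y - z\<bar> \<le> K \<bar>h y - h z\<bar>\<^sup>s\<close>. Pulling a cover back along \<open>h\<close> then yields a cover of a set of Lebesgue
  measure \<open>1\<close> by sets whose lengths are at most \<open>K\<close> times the \<open>s\<close>-gauges, so the \<open>s\<close>-dimensional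
  measure is at least \<open>1 / K\<close> (\<open>hausdorff_measure_pos\<close>).

  The map \<open>h\<close> reads the base \<open>m\<close> digits of \<open>y\<close> as words \<open>w\<^sub>0, w\<^sub>1, \<dots>\<close> from a set \<open>W\<close> of \<open>m\<close> digit
  blocks and returns the number whose digit sequence is \<open>w\<^sub>0 u\<^sub>0 w\<^sub>1 u\<^sub>1 \<dots>\<close>, where the \<open>u\<^sub>i\<close> do not depend on
  \<open>y\<close>. Two ideas make this work.

  Blocks of nearly full dimension. The inverse branch of the Renyi map along a word \<open>w\<close> is a Moebius
  map which shrinks distances at most by the factor \<open>q\<^sup>2\<close>, where \<open>q\<close> is the denominator of its value at \<open>1\<close>, and
  every reduced fraction in \<open>(0,1]\<close> is the value at \<open>1\<close> of some word. The number of
  fractions with denominator up to \<open>Q\<close> is of order \<open>Q\<^sup>2\<close>. Sorting their words by the number of digits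
  \<open>\<ge> 3\<close>, which is only logarithmic in \<open>Q\<close>, produces a prefix-free set of more than \<open>Q\<^bsup>2s\<^esup>\<close> words (\<open>rich_prefix_code\<close>): the
  number of blocks beats the contraction raised to the power \<open>s\<close>, with a factor \<open>2\<close> to spare at every
  step (\<open>block_coding\<close>).

  Fillers that fix the mean. The words \<open>u\<^sub>i\<close> are empty except at the positions where \<open>i + 1\<close> is a
  square. The \<open>j\<close>-th nonempty one is a run of about \<open>4 j\<^sup>3\<close> digits \<open>2\<close> followed by one
  digit that carries the excess of the mean over \<open>2\<close>. It shrinks distances only by a factor
  polynomial in \<open>j\<close>, and only about \<open>\<surd>k\<close> of them occur among the first \<open>k\<close> blocks, so the total cost is subexponential and is absorbed by the factor \<open>2\<close>. On the other hand
  the first \<open>j\<close> fillers contain about \<open>j\<^sup>4\<close> digits against \<open>O(j\<^sup>2)\<close> from the blocks, so they alone determine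
  the mean, and their last digits are chosen so that it tends to \<open>\<alpha>\<close>.\<close>

section \<open>Inverse branches of the Renyi map\<close>

fun branch :: "nat list \<Rightarrow> real \<Rightarrow> real" where
  "branch [] y = y"
| "branch (b # w) y = 1 - 1 / (real b - 1 + branch w y)"

text \<open>The denominator \<open>c y + d\<close> of the Moebius map \<open>y \<mapsto> branch w y = (a y + b) / (c y + d)\<close> with
  determinant \<open>1\<close>, written as a product along the word, in the form suited to induction over words.\<close>

fun den :: "nat list \<Rightarrow> real \<Rightarrow> real" where
  "den [] y = 1"
| "den (b # w) y = (real b - 1 + branch w y) * den w y"

abbreviation admissible :: "nat list \<Rightarrow> bool" where
  "admissible w \<equiv> (\<forall>b \<in> set w. 2 \<le> b)"

lemma branch_append: "branch (v @ w) y = branch v (branch w y)"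
  by (induction v) auto

lemma den_append: "den (v @ w) y = den v (branch w y) * den w y"
  by (induction v) (auto simp: branch_append)

lemma branch_bounds:
  assumes "admissible w" "0 \<le> y" "y \<le> 1"
  shows "0 \<le> branch w y \<and> branch w y \<le> 1"
  using assms
proof (induction w)
  case (Cons b w)
  then have "2 \<le> real b" "0 \<le> branch w y" by auto
  then show ?case by (auto simp: divide_simps)
qed auto

lemma branch_Cons_bounds:
  assumes "admissible (b # w)" "0 \<le> y" "y \<le> 1"
  shows "1 - 1 / (real b - 1) \<le> branch (b # w) y" "branch (b # w) y \<le> 1 - 1 / real b"
proof -
  have "2 \<le> real b" "0 \<le> branch w y" "branch w y \<le> 1"
    using assms branch_bounds[of w y] by auto
  then show "1 - 1 / (real b - 1) \<le> branch (b # w) y" "branch (b # w) y \<le> 1 - 1 / real b"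
    by (auto intro!: divide_left_mono mult_pos_pos)
qed

lemma branch_less_one:
  assumes "admissible w" "w \<noteq> [] \<or> y < 1" "0 \<le> y" "y \<le> 1"
  shows "branch w y < 1"
proof (cases w)
  case Nil then show ?thesis using assms by auto
next
  case (Cons b v)
  then have "branch w y \<le> 1 - 1 / real b" "2 \<le> b"
    using branch_Cons_bounds(2)[of b v y] assms by auto
  then show ?thesis by (smt (verit) divide_pos_pos of_nat_0_less_iff less_le_trans zero_less_numeral)
qed

lemma den_ge_1:
  assumes "admissible w" "0 \<le> y" "y \<le> 1"
  shows "1 \<le> den w y"
  using assms
proof (induction w)
  case (Cons b w)
  have "1 * 1 \<le> (real b - 1 + branch w y) * den w y"
    using Cons branch_bounds[of w y] by (intro mult_mono) auto
  then show ?case by simp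
qed auto

text \<open>The difference formula of Moebius maps of determinant \<open>1\<close>. Together with monotonicity of the
  denominator it bounds the contraction of a branch by its denominator at \<open>1\<close> alone, in spite of the neutral
  fixed point \<open>0\<close> of the branch of the digit \<open>2\<close>.\<close>

lemma branch_diff:
  assumes "admissible w" "0 \<le> y" "y \<le> 1" "0 \<le> z" "z \<le> 1"
  shows "branch w y - branch w z = (y - z) / (den w y * den w z)"
  using assms
proof (induction w)
  case (Cons b w)
  define u v where "u = real b - 1 + branch w y" "v = real b - 1 + branch w z"
  have uv: "u > 0" "v > 0"
    using Cons.prems branch_bounds[of w y] branch_bounds[of w z] by (auto simp: u_v_def)
  have d: "den w y > 0" "den w z > 0"
    using Cons.prems den_ge_1[of w y] den_ge_1[of w z] by auto
  have "branch (b # w) y - branch (b # w) z = 1 / v - 1 / u"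
    by (simp add: u_v_def)
  also have "\<dots> = (branch w y - branch w z) / (u * v)"
    using uv by (simp add: field_simps) (simp add: u_v_def)
  also have "\<dots> = (y - z) / (den w y * den w z) / (u * v)"
    using Cons by simp
  also have "\<dots> = (y - z) / (den (b # w) y * den (b # w) z)"
    by (simp add: u_v_def mult_ac)
  finally show ?case .
qed auto

lemma branch_mono:
  assumes "admissible w" "0 \<le> y" "y \<le> z" "z \<le> 1"
  shows "branch w y \<le> branch w z"
  using branch_diff[of w z y] den_ge_1[of w z] den_ge_1[of w y] assms
  by (smt (verit, best) divide_nonneg_nonneg mult_nonneg_nonneg)

lemma den_mono:
  assumes "admissible w" "0 \<le> y" "y \<le> z" "z \<le> 1"
  shows "den w y \<le> den w z"
  using assms
proof (induction w)
  case (Cons b w)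
  show ?case unfolding den.simps
    using Cons branch_bounds[of w y] branch_bounds[of w z] branch_mono[of w y z] den_ge_1[of w y]
    by (intro mult_mono) auto
qed auto

lemma branch_dist_le:
  assumes "admissible w" "0 \<le> y" "y \<le> 1" "0 \<le> z" "z \<le> 1"
  shows "\<bar>branch w y - branch w z\<bar> \<le> \<bar>y - z\<bar>"
proof -
  have d: "1 \<le> den w y" "1 \<le> den w z" using den_ge_1 assms by auto
  then have "1 * 1 \<le> den w y * den w z" by (intro mult_mono) auto
  then have "\<bar>y - z\<bar> / (den w y * den w z) \<le> \<bar>y - z\<bar> / 1" by (intro frac_le) auto
  then show ?thesis
    unfolding branch_diff[OF assms] using d by (simp add: abs_mult)
qed

lemma branch_dist_ge:
  assumes "admissible w" "0 \<le> y" "y \<le> 1" "0 \<le> z" "z \<le> 1"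
  shows "\<bar>y - z\<bar> / (den w 1)\<^sup>2 \<le> \<bar>branch w y - branch w z\<bar>"
proof -
  have d: "1 \<le> den w y" "1 \<le> den w z" using den_ge_1 assms by auto
  have "den w y * den w z \<le> den w 1 * den w 1"
    using den_mono[of w y 1] den_mono[of w z 1] assms d by (intro mult_mono) auto
  moreover have "0 < den w y * den w z" using d by auto
  ultimately have "\<bar>y - z\<bar> / (den w 1)\<^sup>2 \<le> \<bar>y - z\<bar> / (den w y * den w z)"
    unfolding power2_eq_square by (intro frac_le) auto
  also have "\<dots> = \<bar>branch w y - branch w z\<bar>"
    unfolding branch_diff[OF assms] using d by (simp add: abs_mult)
  finally show ?thesis .
qed

lemma den_append_le:
  assumes "admissible v" "admissible w"
  shows "den (v @ w) 1 \<le> den v 1 * den w 1"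
  unfolding den_append using assms den_mono[of v "branch w 1" 1] branch_bounds[of w 1] den_ge_1[of w 1]
  by (intro mult_right_mono) auto

lemma incomparable_words_disjoint:
  assumes "admissible v" "admissible w" "v \<parallel> w"
  shows "branch v 1 \<le> branch w 0 \<or> branch w 1 \<le> branch v 0"
  using assms
proof (induction v arbitrary: w)
  case (Cons b v w')
  then obtain c w where w': "w' = c # w" by (cases w') auto
  have aux: "branch (b # v) 1 \<le> branch (c # w) 0"
    if "b < c" "admissible (b # v)" "admissible (c # w)" for b c :: nat and v w
  proof -
    have "branch (b # v) 1 \<le> 1 - 1 / real b"
      using that(2) by (intro branch_Cons_bounds) auto
    also have "1 / real b \<ge> 1 / (real c - 1)"
      using that by (intro divide_left_mono) auto
    then have "1 - 1 / real b \<le> 1 - 1 / (real c - 1)" by simp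
    also have "\<dots> \<le> branch (c # w) 0"
      using that(3) by (intro branch_Cons_bounds) auto
    finally show ?thesis .
  qed
  consider "b < c" | "c < b" | "b = c" by linarith
  then show ?case
  proof cases
    case 3
    have ad: "admissible v" "admissible w" "admissible [b]" using Cons.prems w' by auto
    have "branch v 1 \<le> branch w 0 \<or> branch w 1 \<le> branch v 0"
      using Cons.prems w' 3 by (intro Cons.IH) (auto simp: parallel_def)
    then have "branch [b] (branch v 1) \<le> branch [b] (branch w 0) \<or>
        branch [b] (branch w 1) \<le> branch [b] (branch v 0)"
      using branch_mono[OF ad(3)] branch_bounds[OF ad(1)] branch_bounds[OF ad(2)]
      by (metis order_refl zero_le_one)
    then show ?thesis using 3 w' by simp
  qed (use Cons.prems w' aux in auto)
qed auto

text \<open>The images of \<open>[0,1]\<close> under incomparable words may touch, but only at the image of \<open>1\<close> of the left one.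
  Points that stay at distance \<open>\<eta>\<close> from \<open>1\<close> before the branch is applied are therefore separated.\<close>

lemma incomparable_words_gap:
  assumes "admissible v" "admissible w" "v \<parallel> w" and "den v 1 \<le> R" "den w 1 \<le> R"
    and "0 \<le> y" "y \<le> 1 - \<eta>" "0 \<le> z" "z \<le> 1 - \<eta>" "0 \<le> \<eta>"
  shows "\<eta> / R\<^sup>2 \<le> \<bar>branch v y - branch w z\<bar>"
proof -
  have aux: "branch v y \<le> branch v 1 - \<eta> / R\<^sup>2"
    if "admissible v" "den v 1 \<le> R" "0 \<le> y" "y \<le> 1 - \<eta>" for v y
  proof -
    have "1 \<le> den v 1" using that den_ge_1 by auto
    then have "\<eta> / R\<^sup>2 \<le> \<bar>1 - y\<bar> / (den v 1)\<^sup>2"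
      using that \<open>0 \<le> \<eta>\<close> by (intro frac_le power_mono) auto
    also have "\<dots> \<le> \<bar>branch v 1 - branch v y\<bar>"
      using that \<open>0 \<le> \<eta>\<close> by (intro branch_dist_ge) auto
    also have "\<dots> = branch v 1 - branch v y"
      using branch_mono[of v y 1] that \<open>0 \<le> \<eta>\<close> by auto
    finally show ?thesis by simp
  qed
  have "branch v 0 \<le> branch v y" "branch w 0 \<le> branch w z"
    using assms by (auto intro!: branch_mono)
  then show ?thesis
    using incomparable_words_disjoint[OF assms(1-3)] aux[of v y] aux[of w z] assms by linarith
qed

lemma renyi_branch:
  assumes "2 \<le> b" "0 \<le> z" "z < 1"
  shows "renyi (branch [b] z) = z" "\<lfloor>1 / (1 - branch [b] z)\<rfloor> = int b - 1"
proof -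
  have e: "1 / (1 - branch [b] z) = real b - 1 + z" using assms by simp
  have "\<lfloor>real b - 1 + z\<rfloor> = int b - 1" using assms by (intro floor_unique) auto
  with e show "\<lfloor>1 / (1 - branch [b] z)\<rfloor> = int b - 1" "renyi (branch [b] z) = z"
    by (simp_all add: renyi_def)
qed

lemma funpow_renyi_branch:
  assumes "admissible w" "0 \<le> z" "z < 1"
  shows "(renyi ^^ length w) (branch w z) = z"
  using assms
proof (induction w)
  case (Cons b w)
  then have "renyi (branch (b # w) z) = branch w z"
    using renyi_branch(1)[of b "branch w z"] branch_bounds[of w z] branch_less_one[of w z] by auto
  then show ?case using Cons by (simp add: funpow_Suc_right del: funpow.simps branch.simps)
qed auto

lemma bcf_digit_branch:
  assumes "admissible w" "0 \<le> z" "z < 1" "i < length w"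
  shows "bcf_digit (Suc i) (branch w z) = int (w ! i)"
proof -
  define y where "y = branch (drop (Suc i) w) z"
  have w: "w = take i w @ [w ! i] @ drop (Suc i) w" using assms(4) by (simp add: id_take_nth_drop)
  have ad: "admissible (take i w)" "2 \<le> w ! i" "admissible (drop (Suc i) w)"
    using assms(1,4) by (auto dest: in_set_takeD in_set_dropD)
  have y: "0 \<le> y" "y < 1"
    using branch_bounds[OF ad(3), of z] branch_less_one[OF ad(3), of z] assms by (auto simp: y_def)
  have b: "0 \<le> branch [w ! i] y" "branch [w ! i] y < 1"
    using branch_bounds[of "[w ! i]" y] branch_less_one[of "[w ! i]" y] ad y by (auto simp del: branch.simps)
  have "branch w z = branch (take i w) (branch [w ! i] y)"
    by (subst w) (simp only: branch_append y_def)
  then have "(renyi ^^ i) (branch w z) = branch [w ! i] y"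
    using funpow_renyi_branch[OF ad(1) b] assms(4) by (simp del: branch.simps)
  then show ?thesis
    using renyi_branch(2)[OF ad(2) y] unfolding bcf_digit_def by simp
qed

lemma bcf_digit_ge_2:
  assumes "0 \<le> x" "x < 1"
  shows "2 \<le> bcf_digit j x"
proof -
  have r: "0 \<le> (renyi ^^ n) x \<and> (renyi ^^ n) x < 1" for n
  proof (induction n)
    case (Suc n)
    show ?case unfolding funpow.simps comp_def renyi_def by linarith
  qed (use assms in auto)
  then have "1 \<le> 1 / (1 - (renyi ^^ (j - 1)) x)" by (simp add: le_divide_eq)
  then show ?thesis unfolding bcf_digit_def by linarith
qed

section \<open>Prefix-free sets of words with small denominators\<close>

text \<open>The subtractive Euclidean algorithm, rounding up: with \<open>q' = q - p\<close> and \<open>1 \<le> p' \<le> q'\<close> one has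
  \<open>q = p' + (b - 1) q'\<close> for a unique \<open>b \<ge> 2\<close>, and prefixing the digit \<open>b\<close> turns \<open>p' / q'\<close> into \<open>p / q\<close>.\<close>

lemma word_of_fraction:
  fixes p q :: nat
  assumes "coprime p q" "1 \<le> p" "p \<le> q"
  shows "\<exists>w. admissible w \<and> branch w 1 = real p / real q \<and> den w 1 = real q"
  using assms
proof (induction q arbitrary: p rule: less_induct)
  case (less q)
  show ?case
  proof (cases "p = q")
    case True
    then have "p = 1" "q = 1" using less.prems by auto
    then show ?thesis by (intro exI[of _ "[]"]) auto
  next
    case False
    define q' c p' where "q' = q - p" and "c = (q - 1) div q'" and "p' = (q - 1) mod q' + 1"
    have q': "1 \<le> q'" "q' < q" "q' \<le> q - 1" using False less.prems by (auto simp: q'_def)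
    have c: "1 \<le> c" using q' by (simp add: c_def div_greater_zero_iff Suc_le_eq)
    have "c * q' + (q - 1) mod q' = q - 1" unfolding c_def by (rule div_mult_mod_eq)
    then have q: "q = p' + c * q'" using q' unfolding p'_def by linarith
    have p': "1 \<le> p'" "p' \<le> q'" using q' by (auto simp: p'_def Suc_le_eq)
    have "coprime q q'" using less.prems
      by (simp add: q'_def coprime_commute coprime_diff_one_left_nat)
        (metis coprime_commute gcd_diff2_nat coprime_iff_gcd_eq_1)
    then have "coprime p' q'"
      by (subst (asm) q) (metis coprime_iff_gcd_eq_1 gcd_add_mult gcd.commute add.commute)
    then obtain w where w: "admissible w" "branch w 1 = real p' / real q'" "den w 1 = real q'"
      using less.IH[of q' p'] q' p' by auto
    have s: "(real c + real p' / real q') * real q' = real q"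
      using q' by (subst q) (simp add: field_simps)
    have r: "real c + real p' / real q' = real q / real q'"
      using q' by (subst q) (simp add: field_simps)
    have "1 - 1 / (real q / real q') = real p / real q"
      using q' less.prems by (simp add: q'_def field_simps)
    then show ?thesis using w s r c
      by (intro exI[of _ "Suc c # w"]) auto
  qed
qed

text \<open>A digit \<open>\<ge> 3\<close> at least doubles the denominator, whereas a \<open>2\<close> may increase it only additively. Hence
  the number of digits \<open>\<ge> 3\<close>, unlike the length, is logarithmic in the denominator.\<close>

lemma two_power_le_den:
  assumes "admissible w"
  shows "2 ^ length (filter (\<lambda>b. 3 \<le> b) w) \<le> den w 1"
  using assms
proof (induction w)
  case (Cons b w)
  then have *: "0 \<le> branch w 1" "1 \<le> den w 1" "2 ^ length (filter (\<lambda>b. 3 \<le> b) w) \<le> den w 1"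
    using branch_bounds[of w 1] den_ge_1[of w 1] by auto
  show ?case
  proof (cases "3 \<le> b")
    case True
    then have "2 * 2 ^ length (filter (\<lambda>b. 3 \<le> b) w) \<le> (real b - 1 + branch w 1) * den w 1"
      using * by (intro mult_mono) auto
    then show ?thesis using True by simp
  next
    case False
    have "2 ^ length (filter (\<lambda>b. 3 \<le> b) w) \<le> 1 * den w 1" using * by simp
    also have "\<dots> \<le> (real b - 1 + branch w 1) * den w 1"
      using * Cons.prems by (intro mult_right_mono) auto
    finally show ?thesis using False by simp
  qed
qed auto

lemma sum_inverse_squares_le:
  "(\<Sum>g = 2..n. 1 / (real g)\<^sup>2) \<le> 3 / 4"
proof -
  have *: "(\<Sum>g = 2..n. 1 / (real g)\<^sup>2) \<le> 3 / 4 - 1 / real n"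
    if "2 \<le> n" for n
    using that
  proof (induction n rule: nat_induct_at_least)
    case (Suc n)
    have "1 / (real (Suc n))\<^sup>2 \<le> 1 / (real n * real (Suc n))"
      unfolding power2_eq_square using Suc by (intro divide_left_mono mult_right_mono) auto
    also have "\<dots> = 1 / real n - 1 / real (Suc n)" using Suc by (simp add: field_simps)
    finally show ?case using Suc by simp
  qed simp
  show ?thesis
  proof (cases "2 \<le> n")
    case True
    have "0 \<le> 1 / real n" by simp
    with *[OF True] show ?thesis by linarith
  qed auto
qed

text \<open>Of the \<open>Q\<^sup>2\<close> pairs in \<open>{1..Q}\<^sup>2\<close> at most \<open>Q\<^sup>2 \<Sum>\<^sub>g\<^sub>\<ge>\<^sub>2 1/g\<^sup>2 \<le> 3/4 Q\<^sup>2\<close> have a common factor \<open>g\<close>; exchanging the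
  entries accounts for another factor \<open>2\<close>.\<close>

lemma card_coprime_pairs_ge:
  "(real Q)\<^sup>2 / 8 \<le> real (card {(p, q). 1 \<le> p \<and> p \<le> q \<and> q \<le> Q \<and> coprime p q})"
    (is "_ \<le> real (card ?F)")
proof -
  define N where "N g = (\<lambda>(a, b). (g * a, g * b)) ` ({1..Q div g} \<times> {1..Q div g})" for g :: nat
  have finF: "finite ?F" by (rule finite_subset[of _ "{1..Q} \<times> {1..Q}"]) auto
  have "{1..Q} \<times> {1..Q} \<subseteq> ?F \<union> prod.swap ` ?F \<union> (\<Union>g\<in>{2..Q}. N g)"
  proof (rule subsetI)
    fix x assume "x \<in> {1..Q} \<times> {1..Q}"
    then obtain p q where x: "x = (p, q)" and pq: "p \<in> {1..Q}" "q \<in> {1..Q}" by blast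
    have "(p, q) \<in> (\<Union>g\<in>{2..Q}. N g) \<or> coprime p q"
    proof (rule disjCI)
      assume "\<not> coprime p q"
      define g where "g = gcd p q"
      have "g \<noteq> 1" "g > 0" "g \<le> p"
        using \<open>\<not> coprime p q\<close> pq by (auto simp: g_def coprime_iff_gcd_eq_1 intro!: dvd_imp_le)
      then have g: "g \<in> {2..Q}" using pq by auto
      have "g dvd p" "g dvd q" by (simp_all add: g_def)
      then obtain a b where ab: "p = g * a" "q = g * b" by (elim dvdE)
      then have "a \<le> Q div g" "b \<le> Q div g"
        using pq \<open>g > 0\<close> by (simp_all add: less_eq_div_iff_mult_less_eq mult.commute)
      moreover have "1 \<le> a" "1 \<le> b" using ab pq by (auto intro: Suc_leI gr0I)
      ultimately have "(p, q) \<in> N g" unfolding N_def ab by (intro image_eqI[of _ _ "(a, b)"]) auto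
      then show "(p, q) \<in> (\<Union>g\<in>{2..Q}. N g)" using g by blast
    qed
    moreover have "(p, q) \<in> ?F \<union> prod.swap ` ?F" if "coprime p q"
    proof (cases "p \<le> q")
      case True
      then show ?thesis using that pq by simp
    next
      case False
      then have "(q, p) \<in> ?F" using that pq by (simp add: coprime_commute)
      then have "prod.swap (q, p) \<in> prod.swap ` ?F" by (rule imageI)
      then show ?thesis by simp
    qed
    ultimately show "x \<in> ?F \<union> prod.swap ` ?F \<union> (\<Union>g\<in>{2..Q}. N g)" using x by blast
  qed
  then have "card ({1..Q} \<times> {1..Q}) \<le> card (?F \<union> prod.swap ` ?F \<union> (\<Union>g\<in>{2..Q}. N g))"
    by (intro card_mono finite_UnI finite_imageI finF) (auto simp: N_def)
  also have "\<dots> \<le> card ?F + card (prod.swap ` ?F) + card (\<Union>g\<in>{2..Q}. N g)"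
    by (meson add_mono card_Un_le le_refl order_trans)
  also have "\<dots> \<le> card ?F + card ?F + (\<Sum>g\<in>{2..Q}. card (N g))"
    by (intro add_mono card_image_le card_UN_le finF) auto
  finally have "Q\<^sup>2 \<le> 2 * card ?F + (\<Sum>g\<in>{2..Q}. card (N g))"
    by (simp add: power2_eq_square)
  then have "real (Q\<^sup>2) \<le> real (2 * card ?F + (\<Sum>g\<in>{2..Q}. card (N g)))"
    unfolding of_nat_le_iff .
  also have "\<dots> = 2 * real (card ?F) + (\<Sum>g\<in>{2..Q}. real (card (N g)))" by simp
  also have "(\<Sum>g\<in>{2..Q}. real (card (N g))) \<le> (\<Sum>g\<in>{2..Q}. (real Q)\<^sup>2 * (1 / (real g)\<^sup>2))"
  proof (rule sum_mono)
    fix g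
    have "card (N g) \<le> card ({1..Q div g} \<times> {1..Q div g})"
      unfolding N_def by (intro card_image_le) auto
    then have "real (card (N g)) \<le> real (Q div g) * real (Q div g)"
      by (metis card_atLeastAtMost card_cartesian_product diff_Suc_1 of_nat_le_iff of_nat_mult)
    also have "\<dots> \<le> (real Q / real g) * (real Q / real g)"
      by (intro mult_mono) (auto simp: of_nat_div_le_of_nat)
    finally show "real (card (N g)) \<le> (real Q)\<^sup>2 * (1 / (real g)\<^sup>2)"
      by (simp add: power2_eq_square)
  qed
  also have "\<dots> = (real Q)\<^sup>2 * (\<Sum>g\<in>{2..Q}. 1 / (real g)\<^sup>2)" by (simp add: sum_distrib_left)
  also have "\<dots> \<le> (real Q)\<^sup>2 * (3 / 4)"
    by (intro mult_left_mono sum_inverse_squares_le) auto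
  finally show ?thesis by simp
qed

text \<open>The words of the fractions with denominator at most \<open>Q = 2\<^sup>n\<close> are distinct but some are prefixes of
  others. All of them have at most \<open>n\<close> digits \<open>\<ge> 3\<close>, so some class of words with equally many such digits
  contains at least the fraction \<open>1/(n + 1)\<close> of them. Appending a digit \<open>3\<close> makes such a class prefix-free, since a
  proper extension within the class would have an additional digit \<open>\<ge> 3\<close> at its end. The number of words is
  of order \<open>Q\<^sup>2 / n\<close>, which exceeds the required power of \<open>R = 3 Q\<close> because \<open>s < 1\<close>.\<close>

lemma rich_prefix_code:
  assumes "0 \<le> s" "s < 1"
  obtains W R where "finite W" "1 \<le> R" "2 * R powr (2 * s) \<le> real (card W)"
    "\<forall>w\<in>W. admissible w \<and> w \<noteq> [] \<and> den w 1 \<le> R" "pairwise parallel W"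
proof -
  have "eventually (\<lambda>n. 2 * (3 * 2 ^ n) powr (2 * s) \<le> (2 ^ n)\<^sup>2 / (8 * real (n + 1))) sequentially"
    using assms by real_asymp
  then obtain n where n: "2 * (3 * 2 ^ n) powr (2 * s) \<le> (2 ^ n)\<^sup>2 / (8 * real (n + 1))"
    by (auto simp: eventually_at_top_linorder)
  define Q :: nat where "Q = 2 ^ n"
  define F where "F = {(p, q). 1 \<le> p \<and> p \<le> q \<and> q \<le> Q \<and> coprime p q}"
  have finF: "finite F" unfolding F_def by (rule finite_subset[of _ "{1..Q} \<times> {1..Q}"]) auto
  have "\<forall>x\<in>F. \<exists>w. admissible w \<and> branch w 1 = real (fst x) / real (snd x) \<and> den w 1 = real (snd x)"
    unfolding F_def by (auto intro: word_of_fraction)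
  then obtain f where f: "\<And>p q. (p, q) \<in> F \<Longrightarrow>
      admissible (f (p, q)) \<and> branch (f (p, q)) 1 = real p / real q \<and> den (f (p, q)) 1 = real q"
    by (metis fst_conv snd_conv)
  have inj: "inj_on f F"
  proof (rule inj_onI, clarify)
    fix p q p' q' assume *: "(p, q) \<in> F" "(p', q') \<in> F" "f (p, q) = f (p', q')"
    then have "real q = real q'" "real p / real q = real p' / real q'"
      using f by metis+
    moreover have "q > 0" using * by (auto simp: F_def)
    ultimately show "p = p' \<and> q = q'" by auto
  qed
  define big where "big w = length (filter (\<lambda>b. 3 \<le> b) w)" for w :: "nat list"
  have big: "big (f x) \<in> {..n}" if "x \<in> F" for x
  proof -
    obtain p q where x: "x = (p, q)" by force
    have "2 ^ big (f x) \<le> den (f x) 1"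
      unfolding big_def using f that x by (intro two_power_le_den) auto
    also have "\<dots> \<le> 2 ^ n" using f[of p q] that x by (auto simp: F_def Q_def)
    finally show ?thesis by simp
  qed
  define G where "G k = {x \<in> F. big (f x) = k}" for k
  have "\<exists>k\<in>{..n}. real (card F) / real (n + 1) \<le> real (card (G k))"
  proof (rule ccontr)
    assume "\<not> ?thesis"
    then have lt: "\<And>k. k \<in> {..n} \<Longrightarrow> real (card (G k)) < real (card F) / real (n + 1)"
      by (meson not_le)
    have "F = (\<Union>k\<in>{..n}. G k)" using big by (auto simp: G_def)
    then have "card F \<le> (\<Sum>k\<in>{..n}. card (G k))" by (metis card_UN_le finite_atMost)
    then have "real (card F) \<le> (\<Sum>k\<in>{..n}. real (card (G k)))" by (metis of_nat_le_iff of_nat_sum)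
    also have "\<dots> < (\<Sum>k\<in>{..n}. real (card F) / real (n + 1))"
      using lt by (intro sum_strict_mono) auto
    also have "\<dots> = real (card F)" by simp
    finally show False by simp
  qed
  then obtain k where k: "real (card F) / real (n + 1) \<le> real (card (G k))" by blast
  define W where "W = (\<lambda>x. f x @ [3]) ` G k"
  have GF: "G k \<subseteq> F" by (auto simp: G_def)
  have "inj_on (\<lambda>x. f x @ [3]) (G k)"
    using inj GF by (auto simp: inj_on_def)
  then have cardW: "card W = card (G k)" unfolding W_def by (rule card_image)
  show ?thesis
  proof (rule that[of W "3 * 2 ^ n"])
    show "finite W" unfolding W_def using finF GF finite_subset by blast
    show "1 \<le> (3 * 2 ^ n :: real)"
      using one_le_power[of "2::real" n] by linarith
    have "(2 ^ n)\<^sup>2 / (8 * real (n + 1)) = (real Q)\<^sup>2 / 8 / real (n + 1)" by (simp add: Q_def)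
    also have "\<dots> \<le> real (card F) / real (n + 1)"
      unfolding F_def by (intro divide_right_mono card_coprime_pairs_ge) auto
    finally show "2 * (3 * 2 ^ n) powr (2 * s) \<le> real (card W)"
      using n k cardW by linarith
    show "\<forall>w\<in>W. admissible w \<and> w \<noteq> [] \<and> den w 1 \<le> 3 * 2 ^ n"
    proof
      fix w assume "w \<in> W"
      then obtain p q where w: "w = f (p, q) @ [3]" "(p, q) \<in> F" unfolding W_def using GF by fastforce
      note fpq = f[OF w(2)]
      have "den w 1 \<le> den (f (p, q)) 1 * den [3] 1"
        unfolding w(1) using fpq by (intro den_append_le) auto
      also have "\<dots> \<le> 2 ^ n * 3" using fpq w(2) by (auto simp: F_def Q_def)
      finally show "admissible w \<and> w \<noteq> [] \<and> den w 1 \<le> 3 * 2 ^ n" using w fpq by auto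
    qed
    have big': "big u = k + 1" "u \<noteq> []" "last u = 3" if "u \<in> W" for u
      using that by (auto simp: W_def G_def big_def)
    have False if "prefix v w" "v \<in> W" "w \<in> W" "v \<noteq> w" for v w
    proof -
      obtain u where u: "w = v @ u" using \<open>prefix v w\<close> by (rule prefixE)
      then have "u \<noteq> []" using \<open>v \<noteq> w\<close> by auto
      have "big w = big v + big u" by (simp add: big_def u)
      then have "big u = 0" using big'(1)[OF that(2)] big'(1)[OF that(3)] by simp
      moreover have "last u = 3" using big'(3)[OF that(3)] u \<open>u \<noteq> []\<close> by simp
      then have "3 \<in> set u" using \<open>u \<noteq> []\<close> last_in_set by metis
      ultimately show False by (force simp: big_def filter_empty_conv)
    qed
    then show "pairwise parallel W" unfolding pairwise_def parallel_def by blast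
  qed
qed

section \<open>Bounds for the Hausdorff dimension\<close>

lemma hausdorff_dim_le_1:
  fixes E :: "real set"
  assumes "E \<subseteq> {0..1}"
  shows "hausdorff_dim E \<le> 1"
proof -
  have "hausdorff_measure s E = 0" if s: "1 < s" for s
  proof -
    have pre: "hausdorff_premeasure s \<delta> E \<le> 0" if "0 < \<delta>" for \<delta>
    proof (rule LIMSEQ_le_const)
      have "(\<lambda>n. real n powr (1 - s)) \<longlonglongrightarrow> 0" using s by real_asymp
      then show "(\<lambda>n. ennreal (real n powr (1 - s))) \<longlonglongrightarrow> 0"
        by (metis ennreal_0 tendsto_ennrealI)
      obtain N :: nat where N: "1 / \<delta> < real N" using reals_Archimedean2 by blast
      have "hausdorff_premeasure s \<delta> E \<le> ennreal (real n powr (1 - s))" if n: "N \<le> n" for n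
      proof -
        have n0: "0 < 1 / \<delta>" "1 / \<delta> < real n" using \<open>0 < \<delta>\<close> N n by auto
        have n1: "0 < real n" using n0 by linarith
        have n2: "1 / real n < \<delta>"
          using n1 n0(2) \<open>0 < \<delta>\<close> by (simp add: divide_less_eq mult.commute)
        define U where "U i = (if i < n then {real i / real n..(real i + 1) / real n} else {})" for i
        have diam: "diameter (U i) = 1 / real n" if "i < n" for i
        proof -
          have "real i / real n \<le> (real i + 1) / real n" by (simp add: divide_right_mono)
          then have "diameter {real i / real n..(real i + 1) / real n} = (real i + 1) / real n - real i / real n"
            by simp
          also have "\<dots> = 1 / real n" by (simp add: diff_divide_distrib[symmetric])
          finally show ?thesis using that by (simp add: U_def)
        qed
        have "E \<subseteq> (\<Union>i. U i)"
        proof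
          fix x assume "x \<in> E"
          then have x: "0 \<le> x" "x \<le> 1" using assms by auto
          define i where "i = (if x = 1 then n - 1 else nat \<lfloor>real n * x\<rfloor>)"
          have "i < n \<and> real i \<le> real n * x \<and> real n * x \<le> real i + 1"
          proof (cases "x = 1")
            case False
            then have "real n * x < real n * 1" using x n1 by (intro mult_strict_left_mono) auto
            moreover have "0 \<le> real n * x" using x by simp
            ultimately show ?thesis using False unfolding i_def by simp linarith
          qed (use n1 in \<open>auto simp: i_def\<close>)
          then have "x \<in> U i" using n1 by (simp add: U_def field_simps)
          then show "x \<in> (\<Union>i. U i)" by blast
        qed
        moreover have "bounded (U i) \<and> diameter (U i) \<le> \<delta>" for i
          using diam[of i] n2 \<open>0 < \<delta>\<close> by (cases "i < n") (auto simp: U_def)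
        ultimately have "hausdorff_premeasure s \<delta> E \<le> (\<Sum>i. diam_pow s (U i))"
          unfolding hausdorff_premeasure_def by (intro INF_lower) auto
        also have "\<dots> = (\<Sum>i<n. diam_pow s (U i))"
          by (rule suminf_finite) (auto simp: U_def diam_pow_def)
        also have "\<dots> = (\<Sum>i<n. ennreal ((1 / real n) powr s))"
        proof (rule sum.cong[OF refl])
          fix i assume i: "i \<in> {..<n}"
          have "U i \<noteq> {}" using i by (auto simp: U_def divide_right_mono)
          then show "diam_pow s (U i) = ennreal ((1 / real n) powr s)"
            using diam[of i] i s by (simp add: diam_pow_def)
        qed
        also have "\<dots> = ennreal (real n * (1 / real n) powr s)"
          by (simp add: ennreal_mult ennreal_of_nat_eq_real_of_nat)
        also have "real n * (1 / real n) powr s = real n powr (1 - s)"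
          using n1 by (simp add: powr_diff powr_divide)
        finally show ?thesis .
      qed
      then show "\<exists>N. \<forall>n\<ge>N. hausdorff_premeasure s \<delta> E \<le> ennreal (real n powr (1 - s))" by blast
    qed
    have "hausdorff_measure s E \<le> 0"
      unfolding hausdorff_measure_def by (rule SUP_least) (use pre in auto)
    then show ?thesis by simp
  qed
  then have le: "hausdorff_dim E \<le> ennreal s" if "1 < s" for s
    unfolding hausdorff_dim_def using that by (intro INF_lower) auto
  show ?thesis
  proof (rule ennreal_le_epsilon)
    fix e :: real assume "0 < e"
    then show "hausdorff_dim E \<le> 1 + ennreal e" using le[of "1 + e"] by simp
  qed
qed

text \<open>A form of the mass distribution principle. Lebesgue measure on the parameter set \<open>A\<close>
  takes the place of a measure on \<open>E\<close>. The bound on \<open>\<bar>y - z\<bar>\<close> says that the inverse of \<open>h\<close> is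
  \<open>s\<close>-Hoelder, so the part of \<open>A\<close> that \<open>h\<close> sends into a set \<open>U\<close> lies in an interval of length at most
  \<open>K (diam U)\<^sup>s\<close>.\<close>

lemma hausdorff_measure_pos:
  fixes E :: "'a::metric_space set" and h :: "real \<Rightarrow> 'a"
  assumes "A \<in> sets lborel" "emeasure lborel A = 1" "A \<subseteq> {0..1}" "h ` A \<subseteq> E"
    and "0 \<le> s" "0 < K"
    and lower: "\<And>y z. y \<in> A \<Longrightarrow> z \<in> A \<Longrightarrow> \<bar>y - z\<bar> \<le> K * dist (h y) (h z) powr s"
  shows "hausdorff_measure s E \<noteq> 0"
proof -
  have piece: "\<exists>I \<in> sets lborel. {y \<in> A. h y \<in> U} \<subseteq> I \<and> emeasure lborel I \<le> ennreal K * diam_pow s U"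
    if "bounded U" for U
  proof (cases "{y \<in> A. h y \<in> U} = {}")
    case True
    then show ?thesis by (intro bexI[of _ "{}"]) auto
  next
    case False
    then obtain z where z: "z \<in> A" "h z \<in> U" by blast
    define S where "S = {y \<in> A. h y \<in> U}"
    define D where "D = K * (if s = 0 then 1 else diameter U powr s)"
    have D: "\<bar>x - y\<bar> \<le> D" if "x \<in> S" "y \<in> S" for x y
    proof -
      have "dist (h x) (h y) \<le> diameter U"
        using that diameter_bounded_bound[OF \<open>bounded U\<close>] by (auto simp: S_def)
      then have "dist (h x) (h y) powr s \<le> (if s = 0 then 1 else diameter U powr s)"
        using \<open>0 \<le> s\<close> by (auto intro: powr_mono2)
      then have "K * dist (h x) (h y) powr s \<le> D"
        unfolding D_def using \<open>0 < K\<close> by (intro mult_left_mono) auto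
      then show ?thesis using lower[of x y] that by (auto simp: S_def)
    qed
    have zS: "z \<in> S" using z by (simp add: S_def)
    have bdd: "bdd_below S" "bdd_above S"
      using assms(3) by (auto simp: S_def intro!: bdd_belowI[of _ 0] bdd_aboveI[of _ 1])
    have "Sup S - D \<le> y" if "y \<in> S" for y
    proof -
      have "Sup S \<le> y + D"
      proof (rule cSup_least)
        fix x assume "x \<in> S"
        then show "x \<le> y + D" using D[of x y] that by linarith
      qed (use zS in auto)
      then show ?thesis by simp
    qed
    then have "S \<subseteq> {Sup S - D..Sup S}" using bdd by (auto intro: cSup_upper)
    moreover have "emeasure lborel {Sup S - D..Sup S} \<le> ennreal K * diam_pow s U"
    proof -
      have "0 \<le> D" using D[OF zS zS] by simp
      moreover have "ennreal K * diam_pow s U = ennreal D"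
        using z \<open>0 < K\<close> by (auto simp: diam_pow_def D_def ennreal_mult)
      ultimately show ?thesis by simp
    qed
    ultimately show ?thesis unfolding S_def by (intro bexI[of _ "{Sup S - D..Sup S}"]) (auto simp: S_def)
  qed
  have pre: "ennreal (1 / K) \<le> hausdorff_premeasure s \<delta> E" for \<delta>
    unfolding hausdorff_premeasure_def
  proof (rule INF_greatest)
    fix U :: "nat \<Rightarrow> 'a set"
    assume "U \<in> {U. E \<subseteq> (\<Union>i. U i) \<and> (\<forall>i. bounded (U i) \<and> diameter (U i) \<le> \<delta>)}"
    then have U: "E \<subseteq> (\<Union>i. U i)" "\<And>i. bounded (U i)" by auto
    have "\<exists>I. I \<in> sets lborel \<and> {y \<in> A. h y \<in> U i} \<subseteq> I \<and> emeasure lborel I \<le> ennreal K * diam_pow s (U i)" for i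
      using piece[OF U(2)] by blast
    then obtain I where I: "\<And>i. I i \<in> sets lborel" "\<And>i. {y \<in> A. h y \<in> U i} \<subseteq> I i"
      "\<And>i. emeasure lborel (I i) \<le> ennreal K * diam_pow s (U i)" by metis
    have "A \<subseteq> (\<Union>i. I i)"
    proof
      fix y assume "y \<in> A"
      then have "h y \<in> E" using assms(4) by blast
      then obtain i where "h y \<in> U i" using U by blast
      then show "y \<in> (\<Union>i. I i)" using I(2)[of i] \<open>y \<in> A\<close> by blast
    qed
    then have "1 \<le> emeasure lborel (\<Union>i. I i)"
      unfolding assms(2)[symmetric] using I(1) by (intro emeasure_mono) auto
    also have "\<dots> \<le> (\<Sum>i. emeasure lborel (I i))"
      using I(1) by (intro emeasure_subadditive_countably) auto
    also have "\<dots> \<le> (\<Sum>i. ennreal K * diam_pow s (U i))"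
      by (intro suminf_le I) auto
    also have "\<dots> = ennreal K * (\<Sum>i. diam_pow s (U i))" by simp
    finally have *: "1 \<le> ennreal K * (\<Sum>i. diam_pow s (U i))" .
    have "ennreal (1 / K) * 1 \<le> ennreal (1 / K) * (ennreal K * (\<Sum>i. diam_pow s (U i)))"
      using * by (intro mult_left_mono) auto
    also have "\<dots> = (\<Sum>i. diam_pow s (U i))"
      using \<open>0 < K\<close> by (simp add: mult.assoc[symmetric] ennreal_mult[symmetric])
    finally show "ennreal (1 / K) \<le> (\<Sum>i. diam_pow s (U i))" by simp
  qed
  have "ennreal (1 / K) \<le> hausdorff_measure s E"
    unfolding hausdorff_measure_def by (rule SUP_upper2[of 1]) (use pre in auto)
  moreover have "0 < ennreal (1 / K)" using \<open>0 < K\<close> by simp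
  ultimately show ?thesis by auto
qed

lemma hausdorff_dim_ge_1:
  assumes "\<And>s. 0 \<le> s \<Longrightarrow> s < 1 \<Longrightarrow> hausdorff_measure s E \<noteq> 0"
  shows "1 \<le> hausdorff_dim E"
  unfolding hausdorff_dim_def
proof (rule INF_greatest)
  fix s assume "s \<in> {s. 0 \<le> s \<and> hausdorff_measure s E = 0}"
  then have "1 \<le> s" using assms[of s] by force
  then show "1 \<le> ennreal s" by simp
qed

section \<open>Numbers with prescribed digit blocks\<close>

text \<open>The value \<open>x k\<close> is the number whose digit sequence is the concatenation of \<open>e k, e (k + 1), \<dots>\<close>. It
  is the limit of the increasing sequence \<open>branch (e k) (\<dots> (branch (e (k + n)) 0))\<close>; that the branches are
  contractions in the weak sense suffices to pass to the limit in the recursion.\<close>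

lemma branch_chain_exists:
  fixes e :: "nat \<Rightarrow> nat list"
  assumes "\<And>k. admissible (e k)" "\<And>k. e k \<noteq> []"
  shows "\<exists>x. \<forall>k. 0 \<le> x k \<and> x k < 1 \<and> x k = branch (e k) (x (Suc k))"
proof -
  \<comment> \<open>\<open>a n k\<close> applies the branches of \<open>e k, \<dots>, e (k + n - 1)\<close> to \<open>0\<close>.\<close>
  define a where "a n k = rec_nat (\<lambda>_. 0) (\<lambda>_ r k. branch (e k) (r (Suc k))) n k" for n k
  have a0: "a 0 k = 0" and aS: "a (Suc n) k = branch (e k) (a n (Suc k))" for n k
    by (simp_all add: a_def)
  have a01: "0 \<le> a n k \<and> a n k \<le> 1" for n k
    by (induction n arbitrary: k) (use branch_bounds assms in \<open>auto simp: a0 aS\<close>)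
  have "a n k \<le> a (Suc n) k" for n k
  proof (induction n arbitrary: k)
    case 0 show ?case using a01 by (simp add: a0)
  next
    case (Suc n)
    have "branch (e k) (a n (Suc k)) \<le> branch (e k) (a (Suc n) (Suc k))"
      using Suc a01 assms by (intro branch_mono) auto
    then show ?case by (simp only: aS)
  qed
  then have inc: "incseq (\<lambda>n. a n k)" for k by (intro incseq_SucI)
  have "\<exists>l. (\<lambda>n. a n k) \<longlonglongrightarrow> l" for k
    using incseq_convergent[OF inc, of k 1] a01 by metis
  then obtain x where x: "\<And>k. (\<lambda>n. a n k) \<longlonglongrightarrow> x k" by metis
  have x01: "0 \<le> x k" "x k \<le> 1" for k
    using LIMSEQ_le_const[OF x, of 0 k] LIMSEQ_le_const2[OF x, of k 1] a01 by blast+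
  have eq: "x k = branch (e k) (x (Suc k))" for k
  proof (rule LIMSEQ_unique[OF LIMSEQ_Suc[OF x]])
    have "(\<lambda>n. a (Suc n) k - branch (e k) (x (Suc k))) \<longlonglongrightarrow> 0"
    proof (rule tendsto_rabs_zero_cancel, rule tendsto_sandwich)
      show "\<forall>\<^sub>F n in sequentially. 0 \<le> \<bar>a (Suc n) k - branch (e k) (x (Suc k))\<bar>" by simp
      show "\<forall>\<^sub>F n in sequentially. \<bar>a (Suc n) k - branch (e k) (x (Suc k))\<bar> \<le> \<bar>a n (Suc k) - x (Suc k)\<bar>"
        unfolding aS using a01 x01 assms by (intro always_eventually allI branch_dist_le) auto
      show "(\<lambda>n. \<bar>a n (Suc k) - x (Suc k)\<bar>) \<longlonglongrightarrow> 0"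
        using x[of "Suc k"] by (intro tendsto_rabs_zero) (simp add: LIM_zero)
    qed simp
    then show "(\<lambda>n. a (Suc n) k) \<longlonglongrightarrow> branch (e k) (x (Suc k))" by (rule LIM_zero_cancel)
  qed
  have "x k < 1" for k
    using branch_less_one[of "e k" "x (Suc k)"] assms x01 eq[of k] by auto
  then show ?thesis using x01 eq by (intro exI[of _ x]) blast
qed

lemma branch_chain_concat:
  assumes "\<And>k. x k = branch (e k) (x (Suc k))"
  shows "x 0 = branch (concat (map e [0..<k])) (x k)"
proof (induction k)
  case (Suc k)
  show ?case
    by (subst Suc.IH, subst assms[of k]) (simp add: branch_append)
qed simp

section \<open>Coding by base-m digits\<close>

definition base_digit :: "nat \<Rightarrow> nat \<Rightarrow> real \<Rightarrow> nat" where
  "base_digit m i y = nat (\<lfloor>real m ^ Suc i * y\<rfloor> mod int m)"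

lemma floor_eq_of_base_digits:
  assumes "0 < m" "0 \<le> y" "y < 1" "0 \<le> z" "z < 1"
    and "\<And>i. i < k \<Longrightarrow> base_digit m i y = base_digit m i z"
  shows "\<lfloor>real m ^ k * y\<rfloor> = \<lfloor>real m ^ k * z\<rfloor>"
  using assms(6)
proof (induction k)
  case 0
  have "\<lfloor>y\<rfloor> = 0" "\<lfloor>z\<rfloor> = 0" using assms by (auto simp: floor_eq_iff)
  then show ?case by simp
next
  case (Suc k)
  have div: "\<lfloor>real m ^ Suc k * t\<rfloor> div int m = \<lfloor>real m ^ k * t\<rfloor>" for t
    using floor_divide_real_eq_div[of "int m" "real m ^ Suc k * t"] \<open>0 < m\<close> by simp
  have "\<lfloor>real m ^ Suc k * y\<rfloor> mod int m = \<lfloor>real m ^ Suc k * z\<rfloor> mod int m"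
    using Suc.prems[of k] \<open>0 < m\<close> by (simp add: base_digit_def nat_eq_iff del: power_Suc)
  moreover have "\<lfloor>real m ^ Suc k * y\<rfloor> div int m = \<lfloor>real m ^ Suc k * z\<rfloor> div int m"
    unfolding div using Suc by simp
  ultimately show ?case by (metis div_mult_mod_eq)
qed

lemma first_differing_base_digit:
  assumes "2 \<le> m" "0 \<le> y" "y < 1" "0 \<le> z" "z < 1" "y \<noteq> z"
  obtains k where "\<And>i. i < k \<Longrightarrow> base_digit m i y = base_digit m i z"
    "base_digit m k y \<noteq> base_digit m k z" "\<bar>y - z\<bar> \<le> 1 / real m ^ k"
proof -
  have close: "\<bar>y - z\<bar> < 1 / real m ^ k"
    if "\<And>i. i < k \<Longrightarrow> base_digit m i y = base_digit m i z" for k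
  proof -
    have "\<lfloor>real m ^ k * y\<rfloor> = \<lfloor>real m ^ k * z\<rfloor>"
      using assms that by (intro floor_eq_of_base_digits) auto
    then have "\<bar>real m ^ k * y - real m ^ k * z\<bar> < 1" by linarith
    also have "real m ^ k * y - real m ^ k * z = real m ^ k * (y - z)" by (simp add: algebra_simps)
    finally have "real m ^ k * \<bar>y - z\<bar> < 1" by (simp add: abs_mult)
    then show ?thesis using assms(1) by (simp add: less_divide_eq mult.commute)
  qed
  have "\<exists>k. base_digit m k y \<noteq> base_digit m k z"
  proof (rule ccontr)
    assume "\<not> ?thesis"
    then have *: "\<bar>y - z\<bar> < (1 / real m) ^ k" for k using close[of k] by (simp add: power_one_over)
    obtain k where "(1 / real m) ^ k < \<bar>y - z\<bar>"
      using real_arch_pow_inv[of "\<bar>y - z\<bar>" "1 / real m"] assms by auto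
    then show False using *[of k] by simp
  qed
  then obtain k where k: "base_digit m k y \<noteq> base_digit m k z"
    "\<And>i. i < k \<Longrightarrow> base_digit m i y = base_digit m i z"
    using exists_least_iff[of "\<lambda>k. base_digit m k y \<noteq> base_digit m k z"] by blast
  then show ?thesis using that[of k] close[of k] by force
qed

lemma admissible_concat:
  "(\<And>i. i < k \<Longrightarrow> admissible (e i)) \<Longrightarrow> admissible (concat (map e [0..<k]))"
  by auto

lemma den_concat_le:
  assumes "\<And>i. admissible (e i)"
  shows "den (concat (map e [0..<k])) 1 \<le> (\<Prod>i<k. den (e i) 1)"
proof (induction k)
  case (Suc k)
  have "den (concat (map e [0..<Suc k])) 1 \<le> den (concat (map e [0..<k])) 1 * den (e k) 1"
    using assms by (simp, intro den_append_le) auto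
  also have "\<dots> \<le> (\<Prod>i<k. den (e i) 1) * den (e k) 1"
    using Suc den_ge_1[of "e k" 1] assms by (intro mult_right_mono) auto
  finally show ?case by simp
qed simp

text \<open>If the base \<open>m\<close> digits of \<open>y\<close> and \<open>z\<close> first differ at position \<open>k\<close>, then \<open>\<bar>y - z\<bar> \<le> m\<^bsup>-k\<^esup>\<close>. The images
  \<open>h y\<close> and \<open>h z\<close> share the word made of the first \<open>k\<close> blocks and fillers, whose denominator is at most \<open>R\<^sup>k\<close>
  times the denominators of the fillers, and the differing blocks separate them by a fixed gap before the
  branch of that word is applied. So \<open>\<bar>h y - h z\<bar>\<close> is at least a constant times \<open>R\<^bsup>-2k\<^esup> 2\<^bsup>-k\<^esup>\<close>, and
  \<open>m \<ge> 2 R\<^bsup>2s\<^esup>\<close> turns this into the Hoelder bound.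

  Fillers begin with \<open>2\<close> because the gap requires the point after a block to stay away from \<open>1\<close>,
  that is, the next digit to be bounded.\<close>

lemma block_coding:
  assumes s: "0 \<le> s" "s \<le> 1"
    and W: "finite W" "1 \<le> R" "2 * R powr (2 * s) \<le> real (card W)"
      "\<forall>w\<in>W. admissible w \<and> w \<noteq> [] \<and> den w 1 \<le> R" "pairwise parallel W"
    and u: "\<And>i. admissible (u i)" "\<And>i. u i \<noteq> [] \<Longrightarrow> hd (u i) = 2"
    and C: "0 < C" "\<And>k. (\<Prod>i<k. den (u i) 1)\<^sup>2 \<le> C * 2 ^ k"
  obtains h K where "0 < K"
    "\<forall>y. \<exists>w x. (\<forall>i. w i \<in> W) \<and> (\<forall>k. 0 \<le> x k \<and> x k < 1 \<and>
        h y = branch (concat (map (\<lambda>i. w i @ u i) [0..<k])) (x k))"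
    "\<forall>y\<in>{0..<1}. \<forall>z\<in>{0..<1}. y \<noteq> z \<longrightarrow>
        0 < \<bar>h y - h z\<bar> \<and> \<bar>y - z\<bar> \<le> K * \<bar>h y - h z\<bar> powr s"
proof -
  define m where "m = card W"
  have "1 \<le> R powr (2 * s)" using W(2) s by (intro ge_one_powr_ge_zero) auto
  then have m: "2 \<le> m" "2 * R powr (2 * s) \<le> real m" using W(3) by (auto simp: m_def)
  obtain c where c: "bij_betw c {..<m} W"
    using ex_bij_betw_nat_finite[OF W(1)] unfolding m_def by (auto simp: atLeast0LessThan)
  define w where "w y i = c (base_digit m i y)" for y i
  have digit: "base_digit m i y \<in> {..<m}" for i y
    using m by (simp add: base_digit_def nat_less_iff)
  have wW: "w y i \<in> W" for y i
    unfolding w_def using c digit by (auto simp: bij_betw_def)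
  define e where "e y i = w y i @ u i" for y i
  have e: "admissible (e y i)" "e y i \<noteq> []" for y i
    using W(4)[rule_format, OF wW[of y i]] u(1) by (auto simp: e_def)
  have "\<forall>y. \<exists>x. \<forall>k. 0 \<le> x k \<and> x k < 1 \<and> x k = branch (e y k) (x (Suc k))"
    using branch_chain_exists e by blast
  then obtain x where x: "\<And>y k. 0 \<le> x y k" "\<And>y k. x y k < 1"
    "\<And>y k. x y k = branch (e y k) (x y (Suc k))" by metis
  define h where "h y = x y 0" for y
  have hx: "h y = branch (concat (map (e y) [0..<k])) (x y k)" for y k
    unfolding h_def using x(3) by (rule branch_chain_concat)
  have "finite (\<Union>v\<in>W. set v)" using W(1) by auto
  then obtain M0 where M0: "\<And>v b. v \<in> W \<Longrightarrow> b \<in> set v \<Longrightarrow> b \<le> M0"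
    unfolding finite_nat_set_iff_bounded_le by blast
  define M where "M = real (max 2 M0)"
  have M: "2 \<le> M" by (simp add: M_def)
  \<comment> \<open>\<open>t y k\<close> is the point that follows the block \<open>w y k\<close>; its first digit is at most \<open>M\<close>.\<close>
  define t where "t y k = branch (u k) (x y (Suc k))" for y k
  have t: "0 \<le> t y k \<and> t y k \<le> 1 - 1 / M" for y k
  proof -
    have *: "branch (b # l) z \<le> 1 - 1 / M"
      if "admissible (b # l)" "real b \<le> M" "0 \<le> z" "z < 1" for b l z
    proof -
      have "branch (b # l) z \<le> 1 - 1 / real b" using that by (intro branch_Cons_bounds) auto
      also have "1 / M \<le> 1 / real b" using that M by (intro divide_left_mono) auto
      then have "1 - 1 / real b \<le> 1 - 1 / M" by simp
      finally show ?thesis .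
    qed
    have "t y k \<le> 1 - 1 / M"
    proof (cases "u k")
      case Nil
      obtain b l where bl: "w y (Suc k) = b # l" using W(4)[rule_format, OF wW] by (meson neq_Nil_conv)
      then have "real b \<le> M" using M0[OF wW, of b y "Suc k"] by (simp add: M_def)
      moreover have "e y (Suc k) = b # (l @ u (Suc k))" using bl by (simp add: e_def)
      ultimately have "x y (Suc k) \<le> 1 - 1 / M"
        using *[of b "l @ u (Suc k)" "x y (Suc (Suc k))"] x e[of y "Suc k"] by metis
      then show ?thesis using Nil by (simp add: t_def)
    next
      case (Cons b l)
      then have "b = 2" using u(2)[of k] by simp
      have "branch (b # l) (x y (Suc k)) \<le> 1 - 1 / M"
      proof (rule *)
        show "admissible (b # l)" using u(1)[of k] Cons by simp
        show "real b \<le> M" using M \<open>b = 2\<close> by simp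
      qed (rule x)+
      then show ?thesis by (simp only: t_def Cons)
    qed
    moreover have "0 \<le> t y k"
      unfolding t_def using branch_bounds[OF u(1) x(1) less_imp_le[OF x(2)]] by simp
    ultimately show ?thesis by simp
  qed
  define g where "g = 1 / M / R\<^sup>2"
  have g: "0 < g" using M W(2) by (simp add: g_def)
  define K where "K = (C / g) powr s"
  show ?thesis
  proof (rule that[of K h])
    show "0 < K" using C g by (simp add: K_def)
    show "\<forall>y. \<exists>w x. (\<forall>i. w i \<in> W) \<and> (\<forall>k. 0 \<le> x k \<and> x k < 1 \<and>
        h y = branch (concat (map (\<lambda>i. w i @ u i) [0..<k])) (x k))"
      using wW x hx unfolding e_def by blast
    show "\<forall>y\<in>{0..<1}. \<forall>z\<in>{0..<1}. y \<noteq> z \<longrightarrow>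
        0 < \<bar>h y - h z\<bar> \<and> \<bar>y - z\<bar> \<le> K * \<bar>h y - h z\<bar> powr s"
    proof (intro ballI impI)
      fix y z :: real
      assume yz: "y \<in> {0..<1}" "z \<in> {0..<1}" "y \<noteq> z"
      obtain k where k: "\<And>i. i < k \<Longrightarrow> base_digit m i y = base_digit m i z"
        "base_digit m k y \<noteq> base_digit m k z" "\<bar>y - z\<bar> \<le> 1 / real m ^ k"
        using first_differing_base_digit[of m y z] m yz by auto
      define P where "P = concat (map (e y) [0..<k])"
      have "map (e y) [0..<k] = map (e z) [0..<k]" using k(1) by (simp add: e_def w_def)
      then have hP: "h y = branch P (x y k)" "h z = branch P (x z k)"
        unfolding P_def using hx by metis+
      have adP: "admissible P" unfolding P_def using e by (intro admissible_concat) auto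
      have "w y k \<noteq> w z k"
        unfolding w_def using c k(2) digit by (metis bij_betw_def inj_onD)
      then have "g \<le> \<bar>branch (w y k) (t y k) - branch (w z k) (t z k)\<bar>"
        unfolding g_def using W(4)[rule_format, OF wW] pairwiseD[OF W(5) wW wW] t M
        by (intro incomparable_words_gap) auto
      also have "\<dots> = \<bar>x y k - x z k\<bar>"
        using x(3)[of y k] x(3)[of z k] by (simp add: e_def t_def branch_append)
      finally have gap: "g \<le> \<bar>x y k - x z k\<bar>" .
      define V where "V = (\<Prod>i<k. den (u i) 1)"
      have den1: "1 \<le> den (u i) 1" for i using den_ge_1[OF u(1)] by simp
      have V: "0 \<le> V" unfolding V_def by (intro prod_nonneg) (use den1 order_trans[OF zero_le_one] in blast)
      have "den P 1 \<le> (\<Prod>i<k. den (e y i) 1)"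
        unfolding P_def using e by (intro den_concat_le) auto
      also have "\<dots> \<le> (\<Prod>i<k. R * den (u i) 1)"
      proof (intro prod_mono conjI)
        fix i
        show "0 \<le> den (e y i) 1" using den_ge_1[OF e(1), of 1 y i] by simp
        have "den (e y i) 1 \<le> den (w y i) 1 * den (u i) 1"
          unfolding e_def using W(4)[rule_format, OF wW] u(1) by (intro den_append_le) auto
        also have "\<dots> \<le> R * den (u i) 1"
          using W(4)[rule_format, OF wW] den1[of i] by (intro mult_right_mono) auto
        finally show "den (e y i) 1 \<le> R * den (u i) 1" .
      qed
      also have "\<dots> = R ^ k * V" by (simp add: prod.distrib V_def)
      finally have "(den P 1)\<^sup>2 \<le> (R ^ k * V)\<^sup>2"
        using den_ge_1[OF adP, of 1] by (intro power_mono) auto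
      also have "\<dots> = (R ^ k)\<^sup>2 * V\<^sup>2" by (simp add: power_mult_distrib)
      also have "\<dots> \<le> (R ^ k)\<^sup>2 * (C * 2 ^ k)"
        unfolding V_def by (intro mult_left_mono C) auto
      finally have denP: "(den P 1)\<^sup>2 \<le> (R ^ k)\<^sup>2 * (C * 2 ^ k)" .
      have denP0: "0 < (den P 1)\<^sup>2" using den_ge_1[OF adP, of 1] by simp
      have "g / ((R ^ k)\<^sup>2 * (C * 2 ^ k)) \<le> \<bar>x y k - x z k\<bar> / (den P 1)\<^sup>2"
        using gap denP denP0 g by (intro frac_le) auto
      also have "\<dots> \<le> \<bar>h y - h z\<bar>"
        unfolding hP using adP x less_imp_le by (intro branch_dist_ge) blast+
      finally have dist: "g / ((R ^ k)\<^sup>2 * (C * 2 ^ k)) \<le> \<bar>h y - h z\<bar>" .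
      define q where "q = g / ((R ^ k)\<^sup>2 * (C * 2 ^ k))"
      have q: "0 < q" unfolding q_def using g C W(2) by (intro divide_pos_pos mult_pos_pos) auto
      have "((R ^ k)\<^sup>2 * 2 ^ k) powr s = ((R ^ k)\<^sup>2) powr s * (2 ^ k) powr s"
        by (simp add: powr_mult)
      also have "((R ^ k)\<^sup>2) powr s = (R powr (2 * s)) ^ k"
      proof -
        have "(R ^ k)\<^sup>2 = R powr (2 * real k)"
          using W(2) powr_realpow[of R "2 * k"] by (simp add: power_mult[symmetric] mult.commute)
        then show ?thesis using W(2) by (simp add: powr_powr powr_power mult_ac)
      qed
      also have "(2 ^ k) powr s \<le> (2 ^ k :: real) powr 1"
        using s by (intro powr_mono) auto
      then have "(R powr (2 * s)) ^ k * (2 ^ k) powr s \<le> (R powr (2 * s)) ^ k * 2 ^ k"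
        by (intro mult_left_mono) auto
      also have "\<dots> = (2 * R powr (2 * s)) ^ k" by (simp add: power_mult_distrib)
      also have "\<dots> \<le> real m ^ k" using m by (intro power_mono) auto
      finally have pow: "((R ^ k)\<^sup>2 * 2 ^ k) powr s \<le> real m ^ k" .
      have "\<bar>y - z\<bar> \<le> 1 / real m ^ k" by (rule k(3))
      also have "\<dots> \<le> 1 / ((R ^ k)\<^sup>2 * 2 ^ k) powr s"
        using pow W(2) m(1) by (intro divide_left_mono mult_pos_pos) auto
      also have "\<dots> = (C / g * q) powr s"
        using C g by (simp add: q_def powr_divide)
      also have "\<dots> = K * q powr s" using C g q by (simp add: K_def powr_mult[symmetric])
      also have "\<dots> \<le> K * \<bar>h y - h z\<bar> powr s"
        using q dist s C g unfolding q_def[symmetric] K_def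
        by (intro mult_left_mono powr_mono2) auto
      finally have "\<bar>y - z\<bar> \<le> K * \<bar>h y - h z\<bar> powr s" .
      moreover have "0 < \<bar>h y - h z\<bar>" using q dist unfolding q_def by linarith
      ultimately show "0 < \<bar>h y - h z\<bar> \<and> \<bar>y - z\<bar> \<le> K * \<bar>h y - h z\<bar> powr s" by simp
    qed
  qed
qed

section \<open>Sparse fillers\<close>

lemma den_replicate_2:
  "branch (replicate n 2) 1 = 1 / (real n + 1) \<and> den (replicate n 2) 1 = real n + 1"
proof (induction n)
  case (Suc n)
  have "1 - 1 / (real 2 - 1 + 1 / (real n + 1)) = 1 / (real (Suc n) + 1)"
    "(real 2 - 1 + 1 / (real n + 1)) * (real n + 1) = real (Suc n) + 1"
    by (simp_all add: field_simps)
  then show ?case using Suc by simp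
qed simp

text \<open>The exponents telescope: \<open>(j + 1)\<^sup>2 - j\<^sup>2 = 2 j + 1\<close>.\<close>

lemma prod_squared_le_exponential:
  fixes X :: "nat \<Rightarrow> real"
  assumes "\<And>j. 1 \<le> X j" "\<forall>\<^sub>F j in sequentially. (X j)\<^sup>2 \<le> 2 ^ (2 * j + 1)"
  shows "\<exists>C>0. \<forall>r. (\<Prod>j<r. X j)\<^sup>2 \<le> C * 2 ^ r\<^sup>2"
proof -
  obtain N where N: "\<And>j. N \<le> j \<Longrightarrow> (X j)\<^sup>2 \<le> 2 ^ (2 * j + 1)"
    using assms(2) by (auto simp: eventually_at_top_linorder)
  define C where "C = (\<Prod>j<N. X j)\<^sup>2"
  have one: "1 \<le> (\<Prod>j\<in>A. X j)" for A :: "nat set"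
    by (intro prod_ge_1) (use assms in auto)
  have C: "0 < C" unfolding C_def by (intro zero_less_power less_le_trans[OF zero_less_one one])
  have "(\<Prod>j<r. X j)\<^sup>2 \<le> C * 2 ^ r\<^sup>2" for r
  proof (cases "N \<le> r")
    case True
    then show ?thesis
    proof (induction r rule: dec_induct)
      case base
      have "C * 1 \<le> C * 2 ^ N\<^sup>2" using C by (intro mult_left_mono) auto
      then show ?case by (simp add: C_def)
    next
      case (step r)
      have "(\<Prod>j<Suc r. X j)\<^sup>2 = (\<Prod>j<r. X j)\<^sup>2 * (X r)\<^sup>2" by (simp add: power_mult_distrib)
      also have "\<dots> \<le> (C * 2 ^ r\<^sup>2) * 2 ^ (2 * r + 1)"
        using step N[of r] C by (intro mult_mono) auto
      also have "\<dots> = C * 2 ^ (Suc r)\<^sup>2"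
        by (simp add: power_add[symmetric] power2_eq_square algebra_simps)
      finally show ?case .
    qed
  next
    case False
    have "(\<Prod>j<r. X j) \<le> (\<Prod>j<N. X j)"
      using False by (intro prod_mono2) (auto intro: assms order_trans[OF zero_le_one])
    then have "(\<Prod>j<r. X j)\<^sup>2 \<le> C * 1"
      unfolding C_def using one[of "{..<r}"] by simp
    also have "\<dots> \<le> C * 2 ^ r\<^sup>2" using C by (intro mult_left_mono) auto
    finally show ?thesis .
  qed
  then show ?thesis using C by blast
qed

text \<open>The \<open>j\<close>-th filler has a length and a digit surplus over \<open>2\<close> that telescope: the fillers \<open>0, \<dots>, r - 1\<close>
  together have \<open>r\<^sup>4 + r\<close> digits with total surplus \<open>G r\<close> (\<open>filler_sums\<close>). Hence the mean is governed by the
  limit of \<open>G r / r\<^sup>4\<close>.\<close>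

definition filler :: "(nat \<Rightarrow> nat) \<Rightarrow> nat \<Rightarrow> nat list" where
  "filler G j = replicate ((j + 1) ^ 4 - j ^ 4) 2 @ [2 + (G (Suc j) - G j)]"

text \<open>Puts \<open>v j\<close> at the index \<open>i\<close> with \<open>i + 1 = (j + 1)\<^sup>2\<close>, so that exactly \<open>v 0, \<dots>, v (r - 1)\<close> occur before
  the index \<open>r\<^sup>2\<close>.\<close>

definition at_squares :: "(nat \<Rightarrow> 'a list) \<Rightarrow> nat \<Rightarrow> 'a list" where
  "at_squares v i = (if floor_sqrt (Suc i) = floor_sqrt i then [] else v (floor_sqrt i))"

lemma floor_sqrt_Suc_cases:
  "floor_sqrt (Suc i) = floor_sqrt i \<or> floor_sqrt (Suc i) = Suc (floor_sqrt i)"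
  by (simp add: floor_sqrt_Suc)

lemma sum_list_at_squares:
  fixes f :: "'a \<Rightarrow> real"
  shows "(\<Sum>i<k. sum_list (map f (at_squares v i))) = (\<Sum>j<floor_sqrt k. sum_list (map f (v j)))"
proof (induction k)
  case (Suc k)
  then show ?case using floor_sqrt_Suc_cases[of k] by (auto simp: at_squares_def)
qed simp

lemma prod_at_squares:
  fixes f :: "'a list \<Rightarrow> real"
  assumes "f [] = 1"
  shows "(\<Prod>i<k. f (at_squares v i)) = (\<Prod>j<floor_sqrt k. f (v j))"
proof (induction k)
  case (Suc k)
  then show ?case using floor_sqrt_Suc_cases[of k] assms by (auto simp: at_squares_def)
qed simp

lemma sum_list_map_concat:
  fixes f :: "'a \<Rightarrow> real"
  shows "sum_list (map f (concat (map e [0..<k]))) = (\<Sum>i<k. sum_list (map f (e i)))"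
  by (induction k) auto

context
  fixes G :: "nat \<Rightarrow> nat"
  assumes mono_G: "mono G" and G_le: "\<And>j. G j \<le> j ^ 5"
begin

lemma power4_Suc_diff: "1 \<le> (j + 1) ^ 4 - j ^ 4" "j ^ 4 \<le> (j + 1) ^ 4" for j :: nat
proof -
  have "j ^ 4 < (j + 1) ^ 4" by (intro power_strict_mono) auto
  then show "1 \<le> (j + 1) ^ 4 - j ^ 4" "j ^ 4 \<le> (j + 1) ^ 4" by linarith+
qed

lemma admissible_filler: "admissible (filler G j)"
  by (auto simp: filler_def)

lemma hd_filler: "hd (filler G j) = 2"
  using power4_Suc_diff(1)[of j]
  by (cases "(j + 1) ^ 4 - j ^ 4") (auto simp: filler_def)

lemma den_filler_le: "den (filler G j) 1 \<le> (real (j + 1) ^ 4 + 1) * (real (j + 1) ^ 5 + 2)"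
proof -
  have "den (filler G j) 1 \<le> den (replicate ((j + 1) ^ 4 - j ^ 4) 2) 1 * den [2 + (G (Suc j) - G j)] 1"
    unfolding filler_def by (intro den_append_le) auto
  also have "\<dots> = (real ((j + 1) ^ 4 - j ^ 4) + 1) * (2 + real (G (Suc j) - G j))"
    using den_replicate_2 by simp
  also have "\<dots> \<le> (real ((j + 1) ^ 4) + 1) * (2 + real ((j + 1) ^ 5))"
  proof (intro mult_mono add_mono order_refl)
    have "G (Suc j) - G j \<le> (j + 1) ^ 5" using G_le[of "Suc j"] by simp
    then show "real (G (Suc j) - G j) \<le> real ((j + 1) ^ 5)" by (simp only: of_nat_le_iff)
    have "(j + 1) ^ 4 - j ^ 4 \<le> (j + 1) ^ 4" by simp
    then show "real ((j + 1) ^ 4 - j ^ 4) \<le> real ((j + 1) ^ 4)" by (simp only: of_nat_le_iff)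
  qed auto
  finally show ?thesis by (simp add: add.commute)
qed

text \<open>The denominator of a filler grows polynomially, and among the first \<open>k\<close> indices only about \<open>\<surd>k\<close> carry
  a filler. This keeps the product below an exponential of base \<open>2\<close>.\<close>

lemma den_filler_product: "\<exists>C>0. \<forall>k. (\<Prod>i<k. den (at_squares (filler G) i) 1)\<^sup>2 \<le> C * 2 ^ k"
proof -
  have "\<forall>\<^sub>F j in sequentially. ((real (j + 1) ^ 4 + 1) * (real (j + 1) ^ 5 + 2))\<^sup>2 \<le> 2 ^ (2 * j + 1)"
    by real_asymp
  then have "\<forall>\<^sub>F j in sequentially. (den (filler G j) 1)\<^sup>2 \<le> 2 ^ (2 * j + 1)"
  proof eventually_elim
    case (elim j)
    have "(den (filler G j) 1)\<^sup>2 \<le> ((real (j + 1) ^ 4 + 1) * (real (j + 1) ^ 5 + 2))\<^sup>2"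
      using den_filler_le[of j] den_ge_1[OF admissible_filler, of 1 j] by (intro power_mono) auto
    with elim show ?case by simp
  qed
  then obtain C where C: "0 < C" "\<And>r. (\<Prod>j<r. den (filler G j) 1)\<^sup>2 \<le> C * 2 ^ r\<^sup>2"
    using prod_squared_le_exponential[of "\<lambda>j. den (filler G j) 1"] den_ge_1[OF admissible_filler] by force
  have "(\<Prod>i<k. den (at_squares (filler G) i) 1)\<^sup>2 \<le> C * 2 ^ k" for k
  proof -
    have "(\<Prod>i<k. den (at_squares (filler G) i) 1)\<^sup>2 = (\<Prod>j<floor_sqrt k. den (filler G j) 1)\<^sup>2"
      using prod_at_squares[of "\<lambda>w. den w 1"] by simp
    also have "\<dots> \<le> C * 2 ^ (floor_sqrt k)\<^sup>2" by (rule C)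
    also have "\<dots> \<le> C * 2 ^ k"
      using C(1) by (intro mult_left_mono power_increasing) auto
    finally show ?thesis .
  qed
  then show ?thesis using C(1) by blast
qed

lemma filler_sums:
  "(\<Sum>j<r. sum_list (map (\<lambda>_. 1) (filler G j))) = real r ^ 4 + real r"
  "(\<Sum>j<r. sum_list (map (\<lambda>b. real b - 2) (filler G j))) = real (G r)"
proof (induction r)
  case 0
  {
    case 1 then show ?case by simp
  next
    case 2 then show ?case using G_le[of 0] by simp
  }
next
  case (Suc r)
  {
    case 1
    have "real ((r + 1) ^ 4 - r ^ 4) = real ((r + 1) ^ 4) - real (r ^ 4)"
      using power4_Suc_diff(2)[of r] by (rule of_nat_diff)
    then show ?case using Suc by (simp add: filler_def map_replicate_const sum_list_replicate add.commute)
  next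
    case 2
    have "real (G (Suc r) - G r) = real (G (Suc r)) - real (G r)"
      using mono_G by (intro of_nat_diff) (auto simp: mono_def)
    then show ?case using Suc by (simp add: filler_def map_replicate_const sum_list_replicate)
  }
qed

end

section \<open>Means of the digits\<close>

text \<open>Sums of digits are taken as surplus over the minimal digit \<open>2\<close>. This makes the contribution of the runs of
  twos vanish and makes the partial sums monotone.\<close>

lemma partial_sums_of_digits:
  assumes "admissible w" "0 \<le> z" "z < 1"
  shows "(\<Sum>j = 1..length w. real_of_int (bcf_digit j (branch w z)) - 2) = sum_list (map (\<lambda>b. real b - 2) w)"
proof -
  have "(\<Sum>j = 1..length w. real_of_int (bcf_digit j (branch w z)) - 2)
      = (\<Sum>i<length w. real_of_int (bcf_digit (Suc i) (branch w z)) - 2)"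
    by (simp add: sum.atLeast1_atMost_eq)
  also have "\<dots> = (\<Sum>i<length w. real (w ! i) - 2)"
    using assms by (intro sum.cong) (auto simp: bcf_digit_branch)
  also have "\<dots> = sum_list (map (\<lambda>b. real b - 2) w)"
    by (simp add: sum_list_sum_nth atLeast0LessThan)
  finally show ?thesis .
qed

text \<open>For \<open>N j \<le> n < N (j + 1)\<close> monotonicity gives
  \<open>T (N j) / N (j + 1) \<le> T n / n \<le> T (N (j + 1)) / N j\<close>. So the jump of the sum at a large digit causes no
  oscillation as long as consecutive checkpoints have ratio tending to \<open>1\<close>.\<close>

lemma tendsto_by_monotone_subsampling:
  fixes T :: "nat \<Rightarrow> real" and N :: "nat \<Rightarrow> nat" and \<beta> :: ereal
  assumes T: "mono T" "\<And>n. 0 \<le> T n" and N: "N 0 = 0" "\<And>j. j \<le> N j"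
    and lo: "(\<lambda>j. ereal (T (N j) / real (N (Suc j)))) \<longlonglongrightarrow> \<beta>"
    and hi: "(\<lambda>j. ereal (T (N (Suc j)) / real (N j))) \<longlonglongrightarrow> \<beta>"
  shows "(\<lambda>n. ereal (T n / real n)) \<longlonglongrightarrow> \<beta>"
proof -
  \<comment> \<open>the last checkpoint up to \<open>n\<close>\<close>
  define J where "J n = Max {j. N j \<le> n}" for n
  have fin: "finite {j. N j \<le> n}" for n
    by (rule finite_subset[of _ "{..n}"]) (use N(2) order_trans in auto)
  have J1: "N (J n) \<le> n" for n
  proof -
    have "0 \<in> {j. N j \<le> n}" using N(1) by simp
    then show ?thesis using Max_in[OF fin, of n] unfolding J_def by blast
  qed
  have J2: "n < N (Suc (J n))" for n
  proof (rule ccontr)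
    assume "\<not> ?thesis"
    then have "Suc (J n) \<le> Max {j. N j \<le> n}" by (intro Max_ge fin) auto
    then show False by (simp add: J_def)
  qed
  have J_top: "filterlim J at_top sequentially"
    unfolding filterlim_at_top eventually_at_top_linorder
  proof (intro allI exI impI)
    fix k n assume "N k \<le> n"
    then show "k \<le> J n" unfolding J_def by (intro Max_ge fin) auto
  qed
  show ?thesis
  proof (rule tendsto_sandwich)
    show "(\<lambda>n. ereal (T (N (J n)) / real (N (Suc (J n))))) \<longlonglongrightarrow> \<beta>"
      by (rule filterlim_compose[OF lo J_top])
    show "(\<lambda>n. ereal (T (N (Suc (J n))) / real (N (J n)))) \<longlonglongrightarrow> \<beta>"
      by (rule filterlim_compose[OF hi J_top])
    show "\<forall>\<^sub>F n in sequentially. ereal (T (N (J n)) / real (N (Suc (J n)))) \<le> ereal (T n / real n)"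
      using eventually_gt_at_top[of 0]
    proof eventually_elim
      case (elim n)
      show ?case using elim J1[of n] J2[of n] T monoD[OF T(1) J1[of n]] by (auto intro!: frac_le)
    qed
    have "\<forall>\<^sub>F n in sequentially. 1 \<le> J n"
      using J_top unfolding filterlim_at_top by blast
    then show "\<forall>\<^sub>F n in sequentially. ereal (T n / real n) \<le> ereal (T (N (Suc (J n))) / real (N (J n)))"
    proof eventually_elim
      case (elim n)
      have "T n \<le> T (N (Suc (J n)))" using J2[of n] by (intro monoD[OF T(1)]) auto
      moreover have "0 < N (J n)" using elim N(2)[of "J n"] by linarith
      ultimately show ?case using J1[of n] T(2) by (auto intro!: frac_le)
    qed
  qed
qed

text \<open>For finite \<open>\<beta>\<close> one would take \<open>G j = \<lfloor>\<beta> j\<^sup>4\<rfloor>\<close>, and for \<open>\<beta> = \<infinity>\<close> any faster polynomial growth. Replacing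
  \<open>\<beta>\<close> by \<open>min \<beta> j\<close> gives one polynomial bound for all \<open>\<beta>\<close>, without changing the limit.\<close>

lemma fifth_power_target:
  fixes \<beta> :: ereal
  assumes "0 \<le> \<beta>"
  obtains G :: "nat \<Rightarrow> nat" where "mono G" "\<And>j. G j \<le> j ^ 5"
    "(\<lambda>j. ereal (real (G j) / real j ^ 4)) \<longlonglongrightarrow> \<beta>"
proof (cases \<beta>)
  case PInf
  have "filterlim (\<lambda>j. real (j ^ 5) / real j ^ 4) at_top sequentially" by real_asymp
  then have "(\<lambda>j. ereal (real (j ^ 5) / real j ^ 4)) \<longlonglongrightarrow> \<beta>"
    unfolding PInf by (simp add: tendsto_PInfty_eq_at_top)
  moreover have "mono (\<lambda>j :: nat. j ^ 5)" by (auto simp: mono_def intro: power_mono)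
  ultimately show ?thesis using that[of "\<lambda>j. j ^ 5"] by auto
next
  case (real b)
  then have b: "0 \<le> b" using assms by simp
  define G where "G j = nat \<lfloor>min b (real j) * real j ^ 4\<rfloor>" for j
  have G: "real (G j) \<le> min b (real j) * real j ^ 4" "min b (real j) * real j ^ 4 - 1 \<le> real (G j)" for j
  proof -
    have "0 \<le> min b (real j) * real j ^ 4" using b by simp
    then show "real (G j) \<le> min b (real j) * real j ^ 4" "min b (real j) * real j ^ 4 - 1 \<le> real (G j)"
      unfolding G_def by linarith+
  qed
  show ?thesis
  proof (rule that[of G])
    show "mono G"
      unfolding mono_def G_def using b
      by (auto intro!: nat_mono floor_mono mult_mono power_mono)
    show "G j \<le> j ^ 5" for j
    proof -
      have "real (G j) \<le> real j * real j ^ 4"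
        using G(1)[of j] by (rule order_trans) (auto intro: mult_right_mono)
      also have "\<dots> = real (j ^ 5)" by (simp add: eval_nat_numeral)
      finally show ?thesis by (simp only: of_nat_le_iff)
    qed
    have ev: "\<forall>\<^sub>F j in sequentially. max 1 b \<le> real j"
      using filterlim_real_sequentially unfolding filterlim_at_top by blast
    have "(\<lambda>j. real (G j) / real j ^ 4) \<longlonglongrightarrow> b"
    proof (rule tendsto_sandwich)
      show "(\<lambda>j. b - 1 / real j ^ 4) \<longlonglongrightarrow> b" by real_asymp
      show "\<forall>\<^sub>F j in sequentially. b - 1 / real j ^ 4 \<le> real (G j) / real j ^ 4"
        using ev
      proof eventually_elim
        case (elim j)
        then have "(b * real j ^ 4 - 1) / real j ^ 4 \<le> real (G j) / real j ^ 4"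
          using G(2)[of j] by (intro divide_right_mono) (auto simp: min_absorb1)
        then show ?case using elim by (simp add: diff_divide_distrib)
      qed
      show "\<forall>\<^sub>F j in sequentially. real (G j) / real j ^ 4 \<le> b"
        using ev
      proof eventually_elim
        case (elim j)
        then show ?case using G(1)[of j] by (simp add: field_simps min_absorb1)
      qed
    qed simp
    then show "(\<lambda>j. ereal (real (G j) / real j ^ 4)) \<longlonglongrightarrow> \<beta>" by (simp add: real)
  qed
qed (use assms in auto)

text \<open>The perturbations of order \<open>j\<^sup>2\<close> are those caused by the blocks, of which \<open>j\<^sup>2\<close> precede the
  checkpoint \<open>j\<close>.\<close>

lemma ratio_limits:
  fixes t N G :: "nat \<Rightarrow> real" and \<beta> :: ereal
  assumes G: "(\<lambda>j. ereal (G j / real j ^ 4)) \<longlonglongrightarrow> \<beta>"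
    and t: "\<And>j. G j \<le> t j" "\<And>j. t j \<le> G j + K * real j ^ 2"
    and N: "\<And>j. real j ^ 4 \<le> N j" "\<And>j. N j \<le> real j ^ 4 + K * real j ^ 2"
  shows "(\<lambda>j. ereal (t j / N (Suc j))) \<longlonglongrightarrow> \<beta>"
    "(\<lambda>j. ereal (t (Suc j) / N j)) \<longlonglongrightarrow> \<beta>"
proof -
  have t_lim: "(\<lambda>j. ereal (t j / real j ^ 4)) \<longlonglongrightarrow> \<beta>"
  proof (rule tendsto_sandwich)
    show "\<forall>\<^sub>F j in sequentially. ereal (G j / real j ^ 4) \<le> ereal (t j / real j ^ 4)"
      using t(1) by (simp add: divide_right_mono)
    have "(\<lambda>j. K * real j ^ 2 / real j ^ 4) \<longlonglongrightarrow> 0" by real_asymp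
    then have "(\<lambda>j. ereal (G j / real j ^ 4) + ereal (K * real j ^ 2 / real j ^ 4)) \<longlonglongrightarrow> \<beta> + ereal 0"
      by (intro tendsto_add_ereal_general G) auto
    then show "(\<lambda>j. ereal ((G j + K * real j ^ 2) / real j ^ 4)) \<longlonglongrightarrow> \<beta>"
      by (simp add: add_divide_distrib zero_ereal_def[symmetric])
    show "\<forall>\<^sub>F j in sequentially. ereal (t j / real j ^ 4) \<le> ereal ((G j + K * real j ^ 2) / real j ^ 4)"
      using t(2) by (simp add: divide_right_mono)
  qed (rule G)
  have mult: "(\<lambda>j. ereal (f j * g j)) \<longlonglongrightarrow> \<beta>"
    if "(\<lambda>j. ereal (f j)) \<longlonglongrightarrow> \<beta>" "g \<longlonglongrightarrow> 1" for f g
  proof -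
    have "(\<lambda>j. ereal (f j) * ereal (g j)) \<longlonglongrightarrow> \<beta> * ereal 1"
      using that by (intro tendsto_mult_ereal) auto
    then show ?thesis by (simp add: one_ereal_def[symmetric])
  qed
  have pos: "0 < real j ^ 4" "0 < N j" if "0 < j" for j
    using that N(1)[of j] zero_less_power[of "real j" 4] by (simp, linarith)+
  have ev: "\<forall>\<^sub>F j in sequentially. (0::nat) < j" by (rule eventually_gt_at_top)
  have "(\<lambda>j. real j ^ 4 / N (Suc j)) \<longlonglongrightarrow> 1"
  proof (rule tendsto_sandwich)
    show "(\<lambda>j. real j ^ 4 / (real (Suc j) ^ 4 + K * real (Suc j) ^ 2)) \<longlonglongrightarrow> 1" by real_asymp
    show "(\<lambda>j. real j ^ 4 / real (Suc j) ^ 4) \<longlonglongrightarrow> 1" by real_asymp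
    show "\<forall>\<^sub>F j in sequentially. real j ^ 4 / (real (Suc j) ^ 4 + K * real (Suc j) ^ 2) \<le> real j ^ 4 / N (Suc j)"
      using N(2)[of "Suc j" for j] pos(2)[of "Suc j" for j]
      by (intro always_eventually allI frac_le) auto
    show "\<forall>\<^sub>F j in sequentially. real j ^ 4 / N (Suc j) \<le> real j ^ 4 / real (Suc j) ^ 4"
      using N(1)[of "Suc j" for j] by (intro always_eventually allI frac_le) auto
  qed
  from mult[OF t_lim this] have "(\<lambda>j. ereal (t j / real j ^ 4 * (real j ^ 4 / N (Suc j)))) \<longlonglongrightarrow> \<beta>" .
  then show "(\<lambda>j. ereal (t j / N (Suc j))) \<longlonglongrightarrow> \<beta>"
    by (rule Lim_transform_eventually) (use ev in eventually_elim, simp)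
  have "(\<lambda>j. real (Suc j) ^ 4 / N j) \<longlonglongrightarrow> 1"
  proof (rule tendsto_sandwich)
    show "(\<lambda>j. real (Suc j) ^ 4 / (real j ^ 4 + K * real j ^ 2)) \<longlonglongrightarrow> 1" by real_asymp
    show "(\<lambda>j. real (Suc j) ^ 4 / real j ^ 4) \<longlonglongrightarrow> 1" by real_asymp
    show "\<forall>\<^sub>F j in sequentially. real (Suc j) ^ 4 / (real j ^ 4 + K * real j ^ 2) \<le> real (Suc j) ^ 4 / N j"
      using ev
    proof eventually_elim
      case (elim j)
      then show ?case using N(2)[of j] pos[of j] by (intro frac_le) auto
    qed
    show "\<forall>\<^sub>F j in sequentially. real (Suc j) ^ 4 / N j \<le> real (Suc j) ^ 4 / real j ^ 4"
      using ev
    proof eventually_elim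
      case (elim j)
      then show ?case using N(1)[of j] pos[of j] by (intro frac_le) auto
    qed
  qed
  from mult[OF LIMSEQ_Suc[OF t_lim] this]
  show "(\<lambda>j. ereal (t (Suc j) / N j)) \<longlonglongrightarrow> \<beta>" by simp
qed

text \<open>The checkpoints are the ends of the first \<open>j\<^sup>2\<close> blocks with their fillers. Since \<open>W\<close> is finite, the blocks
  contribute \<open>O(j\<^sup>2)\<close> to both the number and the surplus of the digits, whatever blocks are chosen; the
  fillers contribute \<open>j\<^sup>4 + j\<close> and \<open>G j\<close>.\<close>

lemma mean_of_filled_words:
  fixes W :: "nat list set" and \<beta> :: ereal
  assumes W: "finite W" "\<And>w. w \<in> W \<Longrightarrow> admissible w"
    and G: "mono G" "\<And>j. G j \<le> j ^ 5" "(\<lambda>j. ereal (real (G j) / real j ^ 4)) \<longlonglongrightarrow> \<beta>"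
    and w: "\<And>i. w i \<in> W"
    and x: "\<And>k. 0 \<le> x k" "\<And>k. x k < 1"
      "\<And>k. y = branch (concat (map (\<lambda>i. w i @ at_squares (filler G) i) [0..<k])) (x k)"
  shows "(\<lambda>n. ereal (1 / real n * (\<Sum>j = 1..n. real_of_int (bcf_digit j y)))) \<longlonglongrightarrow> \<beta> + 2"
proof -
  define P where "P j = concat (map (\<lambda>i. w i @ at_squares (filler G) i) [0..<j\<^sup>2])" for j
  define N where "N j = length (P j)" for j
  define T where "T n = (\<Sum>j = 1..n. real_of_int (bcf_digit j y) - 2)" for n
  have adu: "admissible (at_squares (filler G) i)" for i
    using admissible_filler[OF G(1,2)] by (auto simp: at_squares_def)
  have adP: "admissible (P j)" for j
    unfolding P_def using adu W(2) w by (intro admissible_concat) auto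
  have y: "0 \<le> y" "y < 1" using x(1)[of 0] x(2)[of 0] x(3)[of 0] by auto
  have yP: "y = branch (P j) (x (j\<^sup>2))" for j unfolding P_def by (rule x(3))
  have wt: "\<exists>K\<ge>0. \<forall>j. (\<Sum>i<j\<^sup>2. sum_list (map f (w i))) \<in> {0..K * real j ^ 2}"
    if "\<And>b. 2 \<le> b \<Longrightarrow> 0 \<le> f b" for f :: "nat \<Rightarrow> real"
  proof -
    define K where "K = (\<Sum>v\<in>W. sum_list (map f v))"
    have pos: "0 \<le> sum_list (map f v)" if "v \<in> W" for v
      using W(2)[OF that] \<open>\<And>b. 2 \<le> b \<Longrightarrow> 0 \<le> f b\<close> by (auto intro!: sum_list_nonneg)
    have "sum_list (map f (w i)) \<le> K" for i
      unfolding K_def using w W(1) pos by (intro member_le_sum) auto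
    then have "(\<Sum>i<j\<^sup>2. sum_list (map f (w i))) \<le> K * real j ^ 2" for j
      using sum_bounded_above[of "{..<j\<^sup>2}" "\<lambda>i. sum_list (map f (w i))" K] by (simp add: mult.commute)
    moreover have "0 \<le> K" unfolding K_def using pos by (intro sum_nonneg)
    ultimately show ?thesis using pos w by (auto intro!: exI[of _ K] sum_nonneg)
  qed
  obtain K1 where K1: "0 \<le> K1" "\<And>j. (\<Sum>i<j\<^sup>2. sum_list (map (\<lambda>_. 1) (w i))) \<in> {0..K1 * real j ^ 2}"
    using wt[of "\<lambda>_. 1"] by auto
  obtain K2 where K2: "0 \<le> K2"
    "\<And>j. (\<Sum>i<j\<^sup>2. sum_list (map (\<lambda>b. real b - 2) (w i))) \<in> {0..K2 * real j ^ 2}"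
    using wt[of "\<lambda>b. real b - 2"] by auto
  have total: "sum_list (map f (P j)) = (\<Sum>i<j\<^sup>2. sum_list (map f (w i))) + (\<Sum>i<j. sum_list (map f (filler G i)))"
    for f :: "nat \<Rightarrow> real" and j
    unfolding P_def sum_list_map_concat by (simp add: sum.distrib sum_list_at_squares)
  have N: "real (N j) = (\<Sum>i<j\<^sup>2. sum_list (map (\<lambda>_. 1) (w i))) + (real j ^ 4 + real j)" for j
  proof -
    have "real (N j) = sum_list (map (\<lambda>_. 1) (P j))" by (simp add: N_def sum_list_triv)
    then show ?thesis unfolding total filler_sums(1)[OF G(1,2)] .
  qed
  have TN: "T (N j) = (\<Sum>i<j\<^sup>2. sum_list (map (\<lambda>b. real b - 2) (w i))) + real (G j)" for j
  proof -
    have "T (N j) = sum_list (map (\<lambda>b. real b - 2) (P j))"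
      using partial_sums_of_digits[OF adP x(1,2), of j "j\<^sup>2"] unfolding T_def N_def yP[symmetric] .
    then show ?thesis unfolding total filler_sums(2)[OF G(1,2)] .
  qed
  define K where "K = K1 + K2 + 1"
  have K: "K1 * real j ^ 2 + real j \<le> K * real j ^ 2" "K2 * real j ^ 2 \<le> K * real j ^ 2" for j
  proof -
    have "real j \<le> real j ^ 2" by (cases j) (auto simp: power2_eq_square)
    moreover have "0 \<le> K1 * real j ^ 2" "0 \<le> K2 * real j ^ 2" using K1(1) K2(1) by auto
    ultimately show "K1 * real j ^ 2 + real j \<le> K * real j ^ 2" "K2 * real j ^ 2 \<le> K * real j ^ 2"
      unfolding K_def distrib_right by linarith+
  qed
  have bounds: "real (G j) \<le> T (N j)" "T (N j) \<le> real (G j) + K * real j ^ 2"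
    "real j ^ 4 \<le> real (N j)" "real (N j) \<le> real j ^ 4 + K * real j ^ 2" for j
    using K1(2)[of j] K2(2)[of j] K[of j] unfolding N TN by auto
  have "(\<lambda>n. ereal (T n / real n)) \<longlonglongrightarrow> \<beta>"
  proof (rule tendsto_by_monotone_subsampling)
    have d: "0 \<le> real_of_int (bcf_digit j y) - 2" for j
      using bcf_digit_ge_2[OF y, of j] by linarith
    show "mono T" unfolding T_def mono_def using d by (auto intro!: sum_mono2)
    show "0 \<le> T n" for n unfolding T_def using d by (intro sum_nonneg)
    show "N 0 = 0" by (simp add: N_def P_def)
    show "j \<le> N j" for j
    proof -
      have "real j \<le> real (N j)" unfolding N using K1(2)[of j] by simp
      then show ?thesis by (simp only: of_nat_le_iff)
    qed
    show "(\<lambda>j. ereal (T (N j) / real (N (Suc j)))) \<longlonglongrightarrow> \<beta>"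
      "(\<lambda>j. ereal (T (N (Suc j)) / real (N j))) \<longlonglongrightarrow> \<beta>"
      using ratio_limits[of "\<lambda>j. real (G j)" \<beta> "\<lambda>j. T (N j)" K "\<lambda>j. real (N j)"] G(3) bounds by auto
  qed
  then have "(\<lambda>n. ereal (T n / real n) + 2) \<longlonglongrightarrow> \<beta> + 2"
    by (intro tendsto_add_ereal_general) auto
  then show ?thesis
  proof (rule Lim_transform_eventually)
    show "\<forall>\<^sub>F n in sequentially. ereal (T n / real n) + 2
        = ereal (1 / real n * (\<Sum>j = 1..n. real_of_int (bcf_digit j y)))"
      using eventually_gt_at_top[of 0]
    proof eventually_elim
      case (elim n)
      have "T n / real n + 2 = 1 / real n * (\<Sum>j = 1..n. real_of_int (bcf_digit j y))"
        using elim by (simp add: T_def sum_subtractf field_simps)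
      then show ?case by (metis numeral_eq_ereal plus_ereal.simps(1))
    qed
  qed
qed

section \<open>The dimension of the level sets\<close>

theorem proposition1p2:
  fixes \<alpha> :: ereal
  assumes "2 \<le> \<alpha>"
  shows "hausdorff_dim {x \<in> {0<..<1::real} - \<rat>.
           (\<lambda>n. ereal (1 / real n * (\<Sum>j = 1..n. real_of_int (bcf_digit j x))))
             \<longlonglongrightarrow> \<alpha>} = 1"
proof (rule antisym)
  let ?E = "{x \<in> {0<..<1::real} - \<rat>.
           (\<lambda>n. ereal (1 / real n * (\<Sum>j = 1..n. real_of_int (bcf_digit j x)))) \<longlonglongrightarrow> \<alpha>}"
  show "hausdorff_dim ?E \<le> 1" by (rule hausdorff_dim_le_1) auto
  define \<beta> where "\<beta> = \<alpha> - 2"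
  have "0 \<le> \<beta>" and \<beta>: "\<beta> + 2 = \<alpha>"
    using assms unfolding \<beta>_def by (cases \<alpha>; simp)+
  obtain G :: "nat \<Rightarrow> nat" where G: "mono G" "\<And>j. G j \<le> j ^ 5"
    "(\<lambda>j. ereal (real (G j) / real j ^ 4)) \<longlonglongrightarrow> \<beta>"
    using fifth_power_target[OF \<open>0 \<le> \<beta>\<close>] by blast
  define u where "u = at_squares (filler G)"
  have u: "admissible (u i)" "u i \<noteq> [] \<Longrightarrow> hd (u i) = 2" for i
    unfolding u_def at_squares_def using admissible_filler[OF G(1,2)] hd_filler[OF G(1,2)] by auto
  obtain C where C: "0 < C" "\<And>k. (\<Prod>i<k. den (u i) 1)\<^sup>2 \<le> C * 2 ^ k"
    using den_filler_product[OF G(1,2)] unfolding u_def by blast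
  show "1 \<le> hausdorff_dim ?E"
  proof (rule hausdorff_dim_ge_1)
    fix s :: real assume s: "0 \<le> s" "s < 1"
    obtain W R where W: "finite W" "1 \<le> R" "2 * R powr (2 * s) \<le> real (card W)"
      and words: "\<forall>w\<in>W. admissible w \<and> w \<noteq> [] \<and> den w 1 \<le> R"
      and free: "pairwise parallel W"
      by (rule rich_prefix_code[OF s])
    obtain h K where K: "0 < K"
      and h: "\<forall>y. \<exists>w x. (\<forall>i. w i \<in> W) \<and> (\<forall>k. 0 \<le> x k \<and> x k < 1 \<and>
        h y = branch (concat (map (\<lambda>i. w i @ u i) [0..<k])) (x k))"
      and low: "\<forall>y\<in>{0..<1}. \<forall>z\<in>{0..<1}. y \<noteq> z \<longrightarrow>
        0 < \<bar>h y - h z\<bar> \<and> \<bar>y - z\<bar> \<le> K * \<bar>h y - h z\<bar> powr s"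
      by (rule block_coding[OF s(1) less_imp_le[OF s(2)] W words free u C])
    have hE: "0 \<le> h y \<and> h y < 1 \<and>
      (\<lambda>n. ereal (1 / real n * (\<Sum>j = 1..n. real_of_int (bcf_digit j (h y))))) \<longlonglongrightarrow> \<alpha>" for y
    proof -
      obtain w x where wx: "\<And>i. w i \<in> W" "\<And>k. 0 \<le> x k" "\<And>k. x k < 1"
        "\<And>k. h y = branch (concat (map (\<lambda>i. w i @ u i) [0..<k])) (x k)"
        using h by blast
      have "(\<lambda>n. ereal (1 / real n * (\<Sum>j = 1..n. real_of_int (bcf_digit j (h y))))) \<longlonglongrightarrow> \<beta> + 2"
        using mean_of_filled_words[of W G \<beta> w x "h y"] W(1) words G wx unfolding u_def by blast
      moreover have "0 \<le> h y \<and> h y < 1" using wx(2)[of 0] wx(3)[of 0] wx(4)[of 0] by simp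
      ultimately show ?thesis unfolding \<beta> by simp
    qed
    have inj: "inj_on h {0..<1}"
      by (rule inj_onI, rule ccontr) (use low in force)
    \<comment> \<open>\<open>h\<close> may take rational values, but being injective it does so only on a countable set.\<close>
    define Z where "Z = {y \<in> {0..<1}. h y \<in> \<rat>}"
    have "countable (h ` Z)"
      by (rule countable_subset[OF _ countable_rat]) (auto simp: Z_def)
    then have Z: "countable Z"
      by (rule countable_image_inj_on) (rule inj_on_subset[OF inj], auto simp: Z_def)
    have Zs: "Z \<in> sets lborel" "emeasure lborel Z = 0"
      using Z by (auto intro: sets.countable emeasure_lborel_countable)
    show "hausdorff_measure s ?E \<noteq> 0"
    proof (rule hausdorff_measure_pos[of "{0..<1} - Z" h])
      show "{0..<1} - Z \<in> sets lborel" using Zs by auto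
      have "emeasure lborel ({0..<1} - Z) = emeasure lborel {0..<1::real}"
        using Zs by (intro emeasure_Diff_null_set) (auto simp: null_sets_def)
      then show "emeasure lborel ({0..<1} - Z) = 1" by simp
      show "{0..<1} - Z \<subseteq> {0..1}" by auto
      show "h ` ({0..<1} - Z) \<subseteq> ?E"
      proof (rule image_subsetI)
        fix y assume y: "y \<in> {0..<1} - Z"
        then have irr: "h y \<notin> \<rat>" by (simp add: Z_def)
        then have "h y \<noteq> 0" by auto
        then show "h y \<in> ?E" using hE[of y] irr by auto
      qed
      show "0 \<le> s" "0 < K" by fact+
      fix y z assume "y \<in> {0..<1} - Z" "z \<in> {0..<1} - Z"
      then show "\<bar>y - z\<bar> \<le> K * dist (h y) (h z) powr s"
        using low by (cases "y = z") (auto simp: dist_real_def)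
    qed
  qed
qed

end
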